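(* Let $\mathbf{G}$ be the set of finite simple undirected graphs (not necessarily connected). For every $G\in\mathbf{G}$, the graph $R_{W_4}(G)$ has a log-concave independence sequence; that is, if $i_k$ denotes the number of independent sets of cardinality $k$ in $R_{W_4}(G)$ and $d$ denotes the maximal cardinality of an independent set of $R_{W_4}(G)$, then $i_k^2\ge i_{k-1}i_{k+1}$ for all $1\le k\le d-1$.
   Context: A subset of vertices of a graph is independent if it contains no two adjacent vertices. The independence sequence of a graph $G$ is the sequence $(i_0,i_1,\dots,i_d)$, where $i_k$ is the number of independent sets of cardinality $k$ and $d$ is the maximal size of an independent set. A non-negative sequence $(s_0,\dots,s_n)$ is log-concave if $s_k^2\ge s_{k-1}s_{k+1}$ for all $k\in\{1,\dots,n-1\}$. The graph $W_4$ has vertices $p_1,p_2,p_3,p_4,q_1,q_2,q_3,q_4$ and edges $p_1p_2,\ p_2p_3,\ p_3p_4$ and $p_jq_j$ for $j=1,2,3,4$ (a path on four vertices with one pendant leaf attached to each path vertex). Its endpoints are $p_1$ and $p_4$. The operator $R_{W_4}$ on graphs replaces every edge by a copy of $W_4$: $R_{W_4}(G)$ is obtained from $G$ by deleting each edge $\{u,v\}$ and adding a new disjoint copy of $W_4$ whose endpoints $p_1,p_4$ are identified with $u$ and $v$ respectively (the other six vertices of the copy are new; the choice of orientation does not matter since $W_4$ is symmetric). *)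

theory Defs
  imports Main
begin

text \<open>An undirected graph is a pair of a vertex set and a set of edges, each edge being the set of
  its two endpoints.\<close>

type_synonym 'a ugraph = "'a set \<times> 'a set set"

abbreviation verts :: "'a ugraph \<Rightarrow> 'a set" where
  "verts G \<equiv> fst G"

abbreviation edges :: "'a ugraph \<Rightarrow> 'a set set" where
  "edges G \<equiv> snd G"

definition finite_simple_graph :: "'a ugraph \<Rightarrow> bool" where
  "finite_simple_graph G \<longleftrightarrow>
     finite (verts G) \<and> (\<forall>e \<in> edges G. e \<subseteq> verts G \<and> card e = 2)"

definition independent :: "'a ugraph \<Rightarrow> 'a set \<Rightarrow> bool" where
  "independent G S \<longleftrightarrow> S \<subseteq> verts G \<and> (\<forall>u \<in> S. \<forall>v \<in> S. {u, v} \<notin> edges G)"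

definition indep_count :: "'a ugraph \<Rightarrow> nat \<Rightarrow> nat" where
  "indep_count G k = card {S. independent G S \<and> card S = k}"

definition indep_number :: "'a ugraph \<Rightarrow> nat" where
  "indep_number G = Max {card S | S. independent G S}"

text \<open>Log-concavity of the finite sequence \<open>s 0, \<dots>, s n\<close>; non-negativity is built into the type.\<close>

definition log_concave_upto :: "nat \<Rightarrow> (nat \<Rightarrow> nat) \<Rightarrow> bool" where
  "log_concave_upto n s \<longleftrightarrow> (\<forall>k. 1 \<le> k \<and> k < n \<longrightarrow> s (k - 1) * s (k + 1) \<le> (s k)\<^sup>2)"

definition log_concave_indep_seq :: "'a ugraph \<Rightarrow> bool" where
  "log_concave_indep_seq G \<longleftrightarrow> log_concave_upto (indep_number G) (indep_count G)"

text \<open>Replacing every edge of \<open>G\<close> by a copy of \<open>H\<close> with distinguished endpoints \<open>a\<close> and \<open>b\<close>.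
  The orientation \<open>t\<close> decides, for each edge, which end is identified with \<open>a\<close> (the first
  component) and which with \<open>b\<close> (the second). \<open>New e x\<close> is the copy belonging to the edge \<open>e\<close> of
  the non-endpoint vertex \<open>x\<close> of \<open>H\<close>.\<close>

datatype ('a, 'b) rvertex = Old 'a | New "'a set" 'b

definition orientation :: "'a ugraph \<Rightarrow> ('a set \<Rightarrow> 'a \<times> 'a) \<Rightarrow> bool" where
  "orientation G t \<longleftrightarrow> (\<forall>e \<in> edges G. {fst (t e), snd (t e)} = e)"

definition copy_vertex ::
  "'b \<Rightarrow> 'b \<Rightarrow> ('a set \<Rightarrow> 'a \<times> 'a) \<Rightarrow> 'a set \<Rightarrow> 'b \<Rightarrow> ('a, 'b) rvertex" where
  "copy_vertex a b t e x =
     (if x = a then Old (fst (t e)) else if x = b then Old (snd (t e)) else New e x)"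

definition replace_edges ::
  "'b ugraph \<Rightarrow> 'b \<Rightarrow> 'b \<Rightarrow> ('a set \<Rightarrow> 'a \<times> 'a) \<Rightarrow> 'a ugraph \<Rightarrow> ('a, 'b) rvertex ugraph" where
  "replace_edges H a b t G =
     (Old ` verts G \<union> (\<Union>e \<in> edges G. copy_vertex a b t e ` verts H),
      \<Union>e \<in> edges G. (\<lambda>f. copy_vertex a b t e ` f) ` edges H)"

datatype w4_vertex = P1 | P2 | P3 | P4 | Q1 | Q2 | Q3 | Q4

definition W4 :: "w4_vertex ugraph" where
  "W4 = (UNIV, {{P1, P2}, {P2, P3}, {P3, P4}, {P1, Q1}, {P2, Q2}, {P3, Q3}, {P4, Q4}})"

definition R_W4 :: "('a set \<Rightarrow> 'a \<times> 'a) \<Rightarrow> 'a ugraph \<Rightarrow> ('a, w4_vertex) rvertex ugraph" where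
  "R_W4 t G = replace_edges W4 P1 P4 t G"

end

theory Submission
  imports "HOL-Computational_Algebra.Polynomial" "HOL-Library.FuncSet" Defs
begin

text \<open>For a graph with \<open>m\<close> edges, summing over the set \<open>S\<close> of old vertices that are chosen turns the
independence polynomial of the edge replacement into
\<open>(1 + x)^m * (\<Sum>S. x^|S| * (\<Prod>e. (1 + x)^(2 - k) * (1 + (3 - k) x)))\<close>, where \<open>k = |e \<inter> S|\<close>
(lemma \<open>independence_sum\<close>). A sequence with generating polynomial \<open>I\<close> is log-concave as soon as the
symmetric polynomial \<open>I(X) I(Y)\<close> is a nonnegative combination of the polynomials \<open>(XY)^m h_k(X, Y)\<close>
(Schur polynomials in two variables): the coefficients of such a polynomial do not decrease
towards the middle of any antidiagonal. This cone, called \<open>schur_pos\<close> below, is closed under sums and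
products, so \<open>I(X) I(Y)\<close> may be cut into convenient pieces.

The product is a sum over pairs \<open>(S, S')\<close>. Fix the intersection \<open>B\<close> of the two sets; every other
vertex is in neither set, only in the set counted by \<open>X\<close>, or only in the one counted by \<open>Y\<close>. Such a
vertex of degree \<open>d\<close> brings, with its leaves, the factor \<open>((1 + X) (1 + Y))^d\<close> when it lies in
neither set, and \<open>Y (1 + X)^d\<close> or \<open>X (1 + Y)^d\<close> when it lies in just one. The two last terms are
unbalanced and need not be Schur positive together, but they are so small compared with the first
that a fraction of it compensates for them. The predicate \<open>dominated\<close> expresses such a compensation
in a way that is compatible with products, so that it applies to many unbalanced vertices at once.

The edges couple the vertices. Apart from the leaves, the weight of an edge as a function of the
marks of its ends (in which of the two sets they lie) is split into a part that depends on one end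
only, a part that depends on the other end only, and a coupled part \<open>6XY\<close>, which is halved by each
marked end and, for two marked ends, multiplied by \<open>2/3\<close> (different marks) or by \<open>0\<close> (equal
marks). Expanding the product over all edges leaves a set \<open>J\<close> of coupled edges, the links, and the
sum over all markings becomes a repulsive lattice gas (\<open>linked_sum\<close>) whose activities are
negative only by a controlled fraction. Its Schur positivity is proved by an induction in the style
of the local lemma (\<open>growing_and_controlled\<close>): releasing one more vertex multiplies the sum at least
by \<open>\<rho>\<close> times the weight of the unmarked vertex, while a cluster of marked vertices costs at most a
factor \<open>2\<close> for each link to a vertex not yet decided. This factor is affordable because
a marked end halves the weight of a link. The numerical conditions (\<open>tame\<close>) follow from domination
alone at degree three and more; at degree at most two they hold because the two unbalanced terms
then have a Schur positive sum, so that only marked neighbours can do harm.\<close>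

section \<open>Schur positive polynomials in two variables\<close>

type_synonym bpoly = "real poly poly"

definition X :: bpoly where "X = [:[:0, 1:]:]"
definition Y :: bpoly where "Y = [:0, 1:]"
definition cst :: "real \<Rightarrow> bpoly" where "cst c = [:[:c:]:]"

abbreviation e1 :: bpoly where "e1 \<equiv> X + Y"
abbreviation e2 :: bpoly where "e2 \<equiv> X * Y"

lemma cst_simps [simp]: "cst 0 = 0" "cst 1 = 1" "cst (numeral n) = numeral n"
  by (simp_all add: cst_def numeral_poly flip: pCons_one)

lemma cst_add: "cst (a + b) = cst a + cst b"
  and cst_mult: "cst (a * b) = cst a * cst b"
  and cst_diff: "cst (a - b) = cst a - cst b"
  by (simp_all add: cst_def)

lemma cst_power: "cst (a ^ n) = cst a ^ n"
  by (induction n) (simp_all add: cst_mult)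

lemma cst_prod: "cst (prod f A) = (\<Prod>a\<in>A. cst (f a))"
  by (induction A rule: infinite_finite_induct) (simp_all add: cst_mult)

text \<open>Complete homogeneous symmetric polynomials \<open>h_k\<close>.\<close>

definition hsym :: "nat \<Rightarrow> bpoly" where "hsym k = (\<Sum>i\<le>k. X ^ i * Y ^ (k - i))"

lemma X_neq_Y: "X - Y \<noteq> 0"
  by (simp add: X_def Y_def)

lemma hsym_0 [simp]: "hsym 0 = 1"
  by (simp add: hsym_def)

lemma X_minus_Y_hsym: "(X - Y) * hsym k = X ^ Suc k - Y ^ Suc k"
  using diff_power_eq_sum[of X k Y] by (simp add: hsym_def lessThan_Suc_atMost)

text \<open>This identity is the reason why products of Schur positive polynomials are Schur positive. It
follows from \<open>(X - Y) h_k = X^(k+1) - Y^(k+1)\<close>.\<close>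

lemma hsym_mult_Suc: "hsym (Suc k) * hsym (Suc l) = hsym (Suc (Suc (k + l))) + e2 * (hsym k * hsym l)"
proof -
  have "(X - Y) * ((X - Y) * (hsym (Suc k) * hsym (Suc l)))
      = ((X - Y) * hsym (Suc k)) * ((X - Y) * hsym (Suc l))"
    by (simp add: algebra_simps)
  also have "\<dots> = (X - Y) * (X ^ Suc (Suc (Suc (k + l))) - Y ^ Suc (Suc (Suc (k + l))))
      + e2 * ((X ^ Suc k - Y ^ Suc k) * (X ^ Suc l - Y ^ Suc l))"
    unfolding X_minus_Y_hsym by (simp add: algebra_simps power_add)
  also have "\<dots> = (X - Y) * ((X - Y) * (hsym (Suc (Suc (k + l))) + e2 * (hsym k * hsym l)))"
    unfolding X_minus_Y_hsym[symmetric] by (simp add: algebra_simps)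
  finally show ?thesis
    using X_neq_Y by simp
qed

lemma hsym_1: "hsym (Suc 0) = e1"
  by (simp add: hsym_def)

lemma hsym_2: "hsym 2 = X^2 + e2 + Y^2"
  by (simp add: hsym_def numeral_2_eq_2)

lemma hsym_3: "hsym 3 = X^3 + X^2 * Y + X * Y^2 + Y^3"
  by (simp add: hsym_def numeral_3_eq_3 numeral_2_eq_2)

text \<open>The polynomials \<open>(XY)^m h_k\<close> are the Schur polynomials in two variables, the characters of the
irreducible polynomial representations of \<open>GL_2\<close>.\<close>

inductive_set schur_pos :: "bpoly set" where
  schur_pos_zero: "0 \<in> schur_pos"
| schur_pos_basis: "0 \<le> c \<Longrightarrow> cst c * e2 ^ m * hsym k \<in> schur_pos"
| schur_pos_add: "F \<in> schur_pos \<Longrightarrow> G \<in> schur_pos \<Longrightarrow> F + G \<in> schur_pos"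

lemma schur_pos_hsym_mult: "0 \<le> c \<Longrightarrow> cst c * e2 ^ m * (hsym k * hsym l) \<in> schur_pos"
proof (induction k arbitrary: l m)
  case 0
  then show ?case by (simp add: schur_pos_basis)
next
  case (Suc k)
  show ?case
  proof (cases l)
    case 0
    then show ?thesis using Suc.prems by (simp add: schur_pos_basis)
  next
    case (Suc l')
    have "cst c * e2 ^ m * hsym (Suc (Suc (k + l'))) + cst c * e2 ^ Suc m * (hsym k * hsym l') \<in> schur_pos"
      using Suc.IH Suc.prems by (intro schur_pos_add schur_pos_basis)
    then show ?thesis
      unfolding Suc hsym_mult_Suc by (simp add: algebra_simps)
  qed
qed

lemma schur_pos_mult:
  assumes "F \<in> schur_pos" "G \<in> schur_pos"
  shows "F * G \<in> schur_pos"
  using assms(1)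
proof (induction F)
  case schur_pos_zero
  then show ?case by (simp add: schur_pos.schur_pos_zero)
next
  case (schur_pos_basis c m k)
  from assms(2) show ?case
  proof (induction G)
    case schur_pos_zero
    then show ?case by (simp add: schur_pos.schur_pos_zero)
  next
    case (schur_pos_basis c' m' k')
    have "cst (c * c') * e2 ^ (m + m') * (hsym k * hsym k') \<in> schur_pos"
      using \<open>0 \<le> c\<close> \<open>0 \<le> c'\<close> by (intro schur_pos_hsym_mult) simp
    then show ?case by (simp add: cst_mult power_add algebra_simps)
  next
    case (schur_pos_add F G)
    then show ?case by (metis schur_pos.schur_pos_add distrib_left)
  qed
next
  case (schur_pos_add F1 F2)
  then show ?case by (metis schur_pos.schur_pos_add distrib_right)
qed

lemma schur_pos_cst: "0 \<le> c \<Longrightarrow> cst c \<in> schur_pos"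
  using schur_pos_basis[of c 0 0] by simp

lemma schur_pos_one: "1 \<in> schur_pos"
  using schur_pos_cst[of 1] by simp

lemma schur_pos_numeral: "numeral n \<in> schur_pos"
  using schur_pos_cst[of "numeral n"] by simp

lemma schur_pos_e1: "e1 \<in> schur_pos"
  using schur_pos_basis[of 1 0 "Suc 0"] by (simp add: hsym_1)

lemma schur_pos_e2: "e2 \<in> schur_pos"
  using schur_pos_basis[of 1 1 0] by simp

lemma schur_pos_hsym: "hsym k \<in> schur_pos"
  using schur_pos_basis[of 1 0 k] by simp

lemma schur_pos_power: "F \<in> schur_pos \<Longrightarrow> F ^ n \<in> schur_pos"
  by (induction n) (auto intro: schur_pos_one schur_pos_mult)

lemma schur_pos_sum: "(\<And>i. i \<in> A \<Longrightarrow> f i \<in> schur_pos) \<Longrightarrow> sum f A \<in> schur_pos"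
  by (induction A rule: infinite_finite_induct) (auto intro: schur_pos_zero schur_pos_add)

lemmas schur_pos_intros = schur_pos_add schur_pos_mult schur_pos_power schur_pos_e1 schur_pos_e2 schur_pos_hsym schur_pos_one schur_pos_numeral schur_pos_cst

definition bcoeff :: "bpoly \<Rightarrow> nat \<Rightarrow> nat \<Rightarrow> real" where
  "bcoeff F i j = coeff (coeff F j) i"

lemma bcoeff_add: "bcoeff (F + G) i j = bcoeff F i j + bcoeff G i j"
  by (simp add: bcoeff_def)

lemma bcoeff_sum: "bcoeff (sum f A) i j = (\<Sum>a\<in>A. bcoeff (f a) i j)"
  by (induction A rule: infinite_finite_induct) (simp_all add: bcoeff_def)

lemma X_Y_power_eq_monom: "cst c * (X ^ a * Y ^ b) = monom (monom c a) b"
proof -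
  have "X ^ a = monom (monom 1 a) 0"
    by (induction a) (simp_all add: X_def monom_0 monom_Suc one_pCons)
  moreover have "Y ^ b = monom 1 b"
    by (induction b) (simp_all add: Y_def monom_0 monom_Suc flip: one_pCons)
  ultimately show ?thesis
    by (simp add: cst_def mult_monom monom_0[symmetric])
qed

lemma bcoeff_monomial: "bcoeff (cst c * (X ^ a * Y ^ b)) i j = (if i = a \<and> j = b then c else 0)"
  unfolding X_Y_power_eq_monom bcoeff_def by simp

text \<open>On the antidiagonal of degree \<open>2 m + k\<close> the coefficients of \<open>(XY)^m h_k\<close> are \<open>1\<close> on a centred interval
and \<open>0\<close> elsewhere, hence they do not decrease towards the middle.\<close>

lemma schur_pos_bcoeff_mono:
  assumes "F \<in> schur_pos" "1 \<le> i" "i \<le> j"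
  shows "bcoeff F (i - 1) (j + 1) \<le> bcoeff F i j"
  using assms(1)
proof induction
  case schur_pos_zero
  then show ?case by (simp add: bcoeff_def)
next
  case (schur_pos_basis c m k)
  have eq: "cst c * e2 ^ m * hsym k = (\<Sum>l\<le>k. cst c * (X ^ (m + l) * Y ^ (m + (k - l))))"
    unfolding hsym_def sum_distrib_left by (intro sum.cong refl) (simp only: power_mult_distrib power_add mult_ac)
  have val: "bcoeff (cst c * e2 ^ m * hsym k) i' j'
      = (if m \<le> i' \<and> m \<le> j' \<and> i' + j' = 2 * m + k then c else 0)" for i' j'
  proof -
    have "bcoeff (cst c * e2 ^ m * hsym k) i' j'
        = (\<Sum>l\<le>k. if l = i' - m \<and> m \<le> i' \<and> j' = m + (k - l) then c else 0)"
      unfolding eq bcoeff_sum bcoeff_monomial by (intro sum.cong) auto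
    also have "\<dots> = (\<Sum>l\<in>{..k} \<inter> {i' - m}. if m \<le> i' \<and> j' = m + (k - l) then c else 0)"
      by (intro sum.mono_neutral_cong_right) auto
    also have "\<dots> = (if m \<le> i' \<and> m \<le> j' \<and> i' + j' = 2 * m + k then c else 0)"
      by (cases "i' - m \<le> k") auto
    finally show ?thesis .
  qed
  show ?case
    unfolding val using assms schur_pos_basis by auto
next
  case (schur_pos_add F G)
  then show ?case by (simp add: bcoeff_add)
qed

subsection \<open>dominated\<close>

section \<open>Domination of unbalanced terms\<close>

text \<open>The position of a vertex that is not in both members of a pair of vertex sets, one counted by \<open>X\<close>
and one counted by \<open>Y\<close>.\<close>

datatype mark = Neither | InY | InX

definition trio :: "'a \<Rightarrow> 'a \<Rightarrow> 'a \<Rightarrow> mark \<Rightarrow> 'a" where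
  "trio p q r s = (case s of Neither \<Rightarrow> p | InY \<Rightarrow> q | InX \<Rightarrow> r)"

lemma trio_simps [simp]: "trio p q r Neither = p" "trio p q r InY = q" "trio p q r InX = r"
  by (simp_all add: trio_def)

lemma mark_fun_eqI: "f Neither = g Neither \<Longrightarrow> f InY = g InY \<Longrightarrow> f InX = g InX \<Longrightarrow> f = g"
  by (rule ext, case_tac x) auto

text \<open>A dominated function consists of a symmetric polynomial at \<open>Neither\<close> and of two mutually swapped
polynomials at \<open>InY\<close> and \<open>InX\<close> that are small compared with it. The prototype is a choice of signs
for the factors of \<open>(X + Y)^n\<close>: some of them are fixed to be \<open>X\<close>, some to be \<open>Y\<close>, some are kept, and
for some pairs of factors \<open>(X + Y)^2\<close> is replaced by the terms \<open>2XY\<close> in which the two signs differ.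
The definition is a convex cone, which allows averages over different choices.\<close>

inductive dominated :: "(mark \<Rightarrow> bpoly) \<Rightarrow> bool" where
  dominated_selection: "dominated (trio (e2 ^ m * e1 ^ (a + b + 2 * k + f))
     (e2 ^ m * (X ^ a * Y ^ b * (2 * e2) ^ k * e1 ^ f))
     (e2 ^ m * (Y ^ a * X ^ b * (2 * e2) ^ k * e1 ^ f)))"
| dominated_slack: "dominated (trio (e2 ^ m * e1 ^ n) 0 0)"
| dominated_add: "dominated F \<Longrightarrow> dominated G \<Longrightarrow> dominated (\<lambda>s. F s + G s)"
| dominated_scale: "0 \<le> c \<Longrightarrow> dominated F \<Longrightarrow> dominated (\<lambda>s. cst c * F s)"

lemma dominated_eq: "dominated F \<Longrightarrow> F = G \<Longrightarrow> dominated G"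
  by simp

text \<open>Products matter because a cluster of marked vertices contributes the product of its weights in one
marking plus the same product with all marks exchanged. Only the factors are estimated below, and
the closure under products then controls both terms together.\<close>

lemma dominated_mult:
  assumes "dominated F" "dominated G"
  shows "dominated (\<lambda>s. F s * G s)"
  using assms(1)
proof induction
  case (dominated_selection m a b k f)
  from assms(2) show ?case
  proof induction
    case (dominated_selection m' a' b' k' f')
    show ?case
      by (rule dominated_eq[OF dominated.dominated_selection[of "m + m'" "a + a'" "b + b'" "k + k'" "f + f'"]],
          rule mark_fun_eqI) (simp_all add: power_add mult_ac algebra_simps)
  next
    case (dominated_slack m' n)
    show ?case
      by (rule dominated_eq[OF dominated.dominated_slack[of "m + m'" "a + b + 2 * k + f + n"]], rule mark_fun_eqI)
        (simp_all add: power_add mult_ac)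
  next
    case (dominated_add F G)
    then show ?case by (simp add: distrib_left dominated.dominated_add)
  next
    case (dominated_scale c F)
    from dominated.dominated_scale[OF dominated_scale(1,3)] show ?case by (simp add: mult_ac)
  qed
next
  case (dominated_slack m n)
  from assms(2) show ?case
  proof induction
    case (dominated_selection m' a' b' k' f')
    show ?case
      by (rule dominated_eq[OF dominated.dominated_slack[of "m + m'" "n + (a' + b' + 2 * k' + f')"]], rule mark_fun_eqI)
        (simp_all add: power_add mult_ac)
  next
    case (dominated_slack m' n')
    show ?case
      by (rule dominated_eq[OF dominated.dominated_slack[of "m + m'" "n + n'"]], rule mark_fun_eqI)
        (simp_all add: power_add mult_ac)
  next
    case (dominated_add F G)
    then show ?case by (simp add: distrib_left dominated.dominated_add)
  next
    case (dominated_scale c F)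
    from dominated.dominated_scale[OF dominated_scale(1,3)] show ?case by (simp add: mult_ac)
  qed
next
  case (dominated_add F1 F2)
  then show ?case by (simp add: distrib_right dominated.dominated_add)
next
  case (dominated_scale c F)
  from dominated.dominated_scale[OF dominated_scale(1,3)] show ?case by (simp add: mult_ac)
qed

lemma e1_mult_hsym_Suc: "e1 * hsym (Suc k) = hsym (Suc (Suc k)) + e2 * hsym k"
  using hsym_mult_Suc[of 0 k] by (simp add: hsym_1)

text \<open>The product \<open>(X + Y)^2 h_k\<close> contains two copies of \<open>XY h_k\<close> if \<open>k > 0\<close>, but only one if \<open>k = 0\<close>.
The next lemmas count how often \<open>(XY)^(i+1) h_k\<close> occurs in \<open>(X + Y)^(k+2+2i)\<close>; for \<open>k = 0\<close> the
exact number is a Catalan number, and \<open>2^i\<close> is a lower bound that suffices.\<close>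

lemma e1_power2_hsym_Suc: "e1 ^ 2 * hsym (Suc k) - 2 * e2 * hsym (Suc k) \<in> schur_pos"
proof -
  have a: "e1 ^ 2 * hsym (Suc k) = hsym (k + 3) + e2 * hsym (Suc k) + e2 * (e1 * hsym k)"
  proof -
    have "e1 ^ 2 * hsym (Suc k) = e1 * (e1 * hsym (Suc k))" by (simp add: power2_eq_square)
    also have "\<dots> = e1 * hsym (Suc (Suc k)) + e2 * (e1 * hsym k)"
      using e1_mult_hsym_Suc[of k] by algebra
    finally show ?thesis
      using e1_mult_hsym_Suc[of "Suc k"] by (simp only: numeral_3_eq_3 add_Suc_right add_0_right)
  qed
  have "e1 * hsym k - hsym (Suc k) \<in> schur_pos"
    by (cases k) (auto simp: hsym_1 e1_mult_hsym_Suc intro: schur_pos_zero schur_pos_mult schur_pos_e2 schur_pos_hsym)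
  then have "hsym (k + 3) + e2 * (e1 * hsym k - hsym (Suc k)) \<in> schur_pos"
    by (intro schur_pos_intros)
  then show ?thesis unfolding a by (simp add: algebra_simps)
qed

lemma e1_power_dominates_hsym: "e1 ^ k - hsym k \<in> schur_pos"
proof (induction k)
  case 0
  then show ?case by (simp add: schur_pos_zero)
next
  case (Suc k)
  have "e1 * hsym k - hsym (Suc k) \<in> schur_pos"
    by (cases k) (auto simp: hsym_1 e1_mult_hsym_Suc intro: schur_pos_zero schur_pos_mult schur_pos_e2 schur_pos_hsym)
  then have "e1 * (e1 ^ k - hsym k) + (e1 * hsym k - hsym (Suc k)) \<in> schur_pos"
    using Suc by (intro schur_pos_intros)
  then show ?case by (simp add: algebra_simps)
qed

lemma e1_even_power_hsym_Suc: "e1 ^ (2 * i) * hsym (Suc k) - 2 ^ i * e2 ^ i * hsym (Suc k) \<in> schur_pos"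
proof (induction i)
  case 0
  then show ?case by (simp add: schur_pos_zero)
next
  case (Suc i)
  have "e1 ^ 2 * (e1 ^ (2 * i) * hsym (Suc k) - 2 ^ i * e2 ^ i * hsym (Suc k))
     + 2 ^ i * e2 ^ i * (e1 ^ 2 * hsym (Suc k) - 2 * e2 * hsym (Suc k)) \<in> schur_pos"
    using Suc e1_power2_hsym_Suc by (intro schur_pos_intros)
  then show ?case by (simp add: algebra_simps power_add power2_eq_square)
qed

lemma e1_square: "e1 ^ 2 = hsym 2 + e2"
  by (simp add: hsym_2 power2_eq_square algebra_simps)

lemma catalan_dominates: "e1 ^ (2 * i + 2) - 2 ^ i * e2 ^ Suc i \<in> schur_pos"
proof (induction i)
  case 0
  have "e1 ^ (2 * 0 + 2) - 2 ^ 0 * e2 ^ Suc 0 = hsym 2"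
    unfolding add_0_left mult_0_right e1_square by simp
  then show ?case using schur_pos_hsym[of 2] by simp
next
  case (Suc i)
  have h2: "e1 ^ (2 * Suc i) * hsym 2 - 2 ^ i * e2 ^ Suc (Suc i) \<in> schur_pos"
  proof -
    have "e1 ^ 2 * (e1 ^ (2 * i) * hsym (Suc 1) - 2 ^ i * e2 ^ i * hsym (Suc 1))
      + 2 ^ i * e2 ^ i * (hsym (Suc 3) + (e2 * hsym 2 + e2 * hsym 2)) \<in> schur_pos"
      using e1_even_power_hsym_Suc[of i 1] by (intro schur_pos_intros)
    moreover have "e1 ^ 2 * (e1 ^ (2 * i) * hsym (Suc 1) - 2 ^ i * e2 ^ i * hsym (Suc 1))
      + 2 ^ i * e2 ^ i * (hsym (Suc 3) + (e2 * hsym 2 + e2 * hsym 2))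
      = e1 ^ (2 * Suc i) * hsym 2 - 2 ^ i * e2 ^ Suc (Suc i)"
    proof -
      have sq: "e1 ^ 2 * hsym 2 = hsym (Suc 3) + (e2 * hsym 2 + e2 * hsym 2) + e2 ^ 2"
        unfolding hsym_def by (simp add: eval_nat_numeral algebra_simps)
      have pw: "e1 ^ (2 * Suc i) = e1 ^ 2 * e1 ^ (2 * i)" "e2 ^ Suc (Suc i) = e2 ^ 2 * e2 ^ i"
        by (simp_all only: power_add mult_Suc_right power_Suc power2_eq_square mult.assoc)
      have h2: "hsym (Suc 1) = hsym 2" by (simp add: numeral_2_eq_2)
      have "s * (A * h - p * B * h) + p * B * (q + (e * h + e * h)) = (s * A) * h - p * (d * B)"
        if "s * h = q + (e * h + e * h) + d" for s h q e d A B p :: bpoly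
        using that by algebra
      from this[OF sq] show ?thesis
        unfolding pw h2 by (simp only:)
    qed
    ultimately show ?thesis by simp
  qed
  have "e1 ^ (2 * Suc i) * hsym 2 - 2 ^ i * e2 ^ Suc (Suc i)
     + e2 * (e1 ^ (2 * i + 2) - 2 ^ i * e2 ^ Suc i) \<in> schur_pos"
    using Suc h2 by (intro schur_pos_intros)
  moreover have "A * h - p * (e2 * q) + e2 * (A - p * q) = A * (h + e2) - 2 * p * (e2 * q)"
    for A h p q :: bpoly
    by (simp add: algebra_simps)
  ultimately show ?case
    by (simp only: power_add[of e1 "2 * i + 2" 2] e1_square power_Suc mult_Suc_right add.commute[of 2])
qed

lemma e1_power_dominates: "e1 ^ (k + 2 + 2 * i) - 2 ^ i * e2 ^ Suc i * hsym k \<in> schur_pos"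
proof (cases k)
  case 0
  then show ?thesis using catalan_dominates[of i] by (simp add: add.commute)
next
  case (Suc l)
  have "e1 ^ (2 * i) * (e1 ^ 2 * (e1 ^ k - hsym k))
     + e1 ^ (2 * i) * (e1 ^ 2 * hsym (Suc l) - 2 * e2 * hsym (Suc l)) 
     + e2 * (e1 ^ (2 * i) * hsym (Suc l) - 2 ^ i * e2 ^ i * hsym (Suc l))
     + e2 * e1 ^ (2 * i) * hsym (Suc l) \<in> schur_pos"
    by (intro schur_pos_add schur_pos_mult[OF _ e1_power_dominates_hsym] schur_pos_mult[OF _ e1_power2_hsym_Suc] schur_pos_mult[OF _ e1_even_power_hsym_Suc] schur_pos_intros)
      (intro schur_pos_mult schur_pos_power schur_pos_e1 e1_power_dominates_hsym)
  then show ?thesis unfolding Suc by (simp add: algebra_simps power_add power2_eq_square)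
qed

lemma power_sum_eq_hsym: "X ^ Suc (Suc c) + Y ^ Suc (Suc c) = hsym (Suc (Suc c)) - e2 * hsym c"
proof -
  have "(X - Y) * (X ^ Suc (Suc c) + Y ^ Suc (Suc c)) = (X - Y) * (hsym (Suc (Suc c)) - e2 * hsym c)"
  proof -
    have "(X - Y) * (hsym (Suc (Suc c)) - e2 * hsym c)
       = (X - Y) * hsym (Suc (Suc c)) - e2 * ((X - Y) * hsym c)"
      by (simp add: algebra_simps)
    then show ?thesis unfolding X_minus_Y_hsym by (simp add: algebra_simps)
  qed
  then show ?thesis using X_neq_Y by simp
qed

text \<open>For \<open>c = b - a \<ge> 2\<close> the only negative part of the two unbalanced terms is
\<open>2^k (XY)^(a+k+1) h_(c-2)\<close>, because \<open>X^c + Y^c = h_c - XY h_(c-2)\<close>. The power of \<open>X + Y\<close> contains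
it at least \<open>2^(a+k)\<close> times.\<close>

lemma selection_sum_schur_pos:
  "e1 ^ (a + b + 2 * k) + X ^ a * Y ^ b * (2 * e2) ^ k + Y ^ a * X ^ b * (2 * e2) ^ k \<in> schur_pos"
proof (induction a b rule: linorder_wlog)
  case (le a b)
  then obtain c where c: "b = a + c" using le_Suc_ex by blast
  have eq: "X ^ a * Y ^ b * (2 * e2) ^ k + Y ^ a * X ^ b * (2 * e2) ^ k
      = 2 ^ k * e2 ^ (a + k) * (X ^ c + Y ^ c)"
    unfolding c by (simp add: algebra_simps power_add)
  show ?case
  proof (cases "2 \<le> c")
    case True
    then obtain d where d: "c = Suc (Suc d)" by (metis Suc_le_D add_2_eq_Suc le_Suc_ex)
    have r: "(2::bpoly) ^ (a + k) - 2 ^ k \<in> schur_pos"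
    proof -
      have "cst (2 ^ (a + k) - 2 ^ k) \<in> schur_pos" by (intro schur_pos_cst) simp
      then show ?thesis by (simp add: cst_diff cst_power)
    qed
    have "(e1 ^ (d + 2 + 2 * (a + k)) - 2 ^ (a + k) * e2 ^ Suc (a + k) * hsym d)
       + (2 ^ (a + k) - 2 ^ k) * e2 ^ Suc (a + k) * hsym d
       + 2 ^ k * e2 ^ (a + k) * hsym (Suc (Suc d)) \<in> schur_pos"
      by (intro schur_pos_add e1_power_dominates schur_pos_mult r schur_pos_intros)
    moreover have "a + b + 2 * k = d + 2 + 2 * (a + k)" using c d by simp
    ultimately show ?thesis
      unfolding add.assoc eq d power_sum_eq_hsym by (simp add: algebra_simps)
  next
    case False
    then have "X ^ c + Y ^ c = 2 \<or> X ^ c + Y ^ c = e1"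
      by (cases "c = 0") (auto simp: le_Suc_eq not_le numeral_2_eq_2 less_Suc_eq)
    then have "X ^ c + Y ^ c \<in> schur_pos" using schur_pos_e1 schur_pos_numeral by metis
    then show ?thesis unfolding add.assoc eq by (intro schur_pos_add[OF _ schur_pos_mult[OF _ \<open>X ^ c + Y ^ c \<in> schur_pos\<close>]] schur_pos_power schur_pos_mult schur_pos_e1 schur_pos_e2 schur_pos_numeral)
  qed
next
  case (sym a b)
  then show ?case by (simp only: add_ac mult_ac)
qed

lemma dominated_Neither_schur_pos: "dominated F \<Longrightarrow> F Neither \<in> schur_pos"
  by (induction rule: dominated.induct) (auto intro: schur_pos_intros)

text \<open>This is what domination is for: the unmarked term compensates for the two unbalanced ones.\<close>

lemma dominated_sum_schur_pos: "dominated F \<Longrightarrow> F Neither + F InY + F InX \<in> schur_pos"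
proof (induction rule: dominated.induct)
  case (dominated_selection m a b k f)
  have "e2 ^ m * e1 ^ f * (e1 ^ (a + b + 2 * k) + X ^ a * Y ^ b * (2 * e2) ^ k + Y ^ a * X ^ b * (2 * e2) ^ k) \<in> schur_pos"
    by (intro schur_pos_mult[OF _ selection_sum_schur_pos] schur_pos_intros)
  then show ?case by (simp add: algebra_simps power_add)
next
  case (dominated_slack m n)
  then show ?case by (auto intro: schur_pos_intros)
next
  case (dominated_add F G)
  from schur_pos_add[OF dominated_add(3,4)] show ?case by (simp add: add_ac)
next
  case (dominated_scale c F)
  from schur_pos_mult[OF schur_pos_cst[OF dominated_scale(1)] dominated_scale(3)] show ?case by (simp add: algebra_simps)
qed

lemma dominated_swap: "dominated F \<Longrightarrow> dominated (trio (F Neither) (F InX) (F InY))"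
proof (induction rule: dominated.induct)
  case (dominated_selection m a b k f)
  show ?case
    by (rule dominated_eq[OF dominated.dominated_selection[of m b a k f]], rule mark_fun_eqI) (simp_all add: add_ac mult_ac)
next
  case (dominated_slack m n)
  show ?case using dominated.dominated_slack[of m n] by simp
next
  case (dominated_add F G)
  show ?case
    by (rule dominated_eq[OF dominated.dominated_add[OF dominated_add(3,4)]], rule mark_fun_eqI) simp_all
next
  case (dominated_scale c F)
  show ?case
    by (rule dominated_eq[OF dominated.dominated_scale[OF dominated_scale(1,3)]], rule mark_fun_eqI) simp_all
qed

section \<open>Markings of a linked set of vertices\<close>

text \<open>The effect on the weight of a vertex of already decided linked neighbours, \<open>a\<close> of them marked \<open>InY\<close> and
\<open>b\<close> marked \<open>InX\<close>: equal marks on a link exclude each other, different ones cost \<open>2/3\<close>.\<close>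

definition touch :: "nat \<Rightarrow> nat \<Rightarrow> mark \<Rightarrow> real" where
  "touch a b = trio 1 (if a = 0 then (2 / 3) ^ b else 0) (if b = 0 then (2 / 3) ^ a else 0)"

definition pair_weight :: "mark \<Rightarrow> mark \<Rightarrow> real" where
  "pair_weight s t = (if s = Neither \<or> t = Neither then 1 else if s = t then 0 else 2 / 3)"

lemma touch_Neither [simp]: "touch a b Neither = 1"
  by (simp add: touch_def)

lemma pair_weight_Neither [simp]: "pair_weight Neither t = 1"
  by (simp add: pair_weight_def)

text \<open>The weight of a link as a function of the set of its two ends, so that no orientation of the links
has to be chosen; on a pair it agrees with \<open>pair_weight\<close> (lemma \<open>link_weight_pair\<close>).\<close>

definition link_weight :: "('v \<Rightarrow> mark) \<Rightarrow> 'v set \<Rightarrow> real" where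
  "link_weight g e = (if \<exists>u\<in>e. g u = Neither then 1 else if \<exists>u\<in>e. \<exists>v\<in>e. g u \<noteq> g v then 2 / 3 else 0)"

lemma link_weight_pair: "link_weight g {u, v} = pair_weight (g u) (g v)"
  by (auto simp: link_weight_def pair_weight_def)

lemma link_weight_cong: "(\<And>u. u \<in> e \<Longrightarrow> g u = g' u) \<Longrightarrow> link_weight g e = link_weight g' e"
  by (simp add: link_weight_def cong: bex_cong)

definition link :: "'v set set \<Rightarrow> 'v \<Rightarrow> 'v set" where
  "link J v = {u. {u, v} \<in> J}"

definition weight :: "('v \<Rightarrow> mark \<Rightarrow> bpoly) \<Rightarrow> 'v set set \<Rightarrow> 'v set \<Rightarrow> ('v \<Rightarrow> nat) \<Rightarrow> ('v \<Rightarrow> nat) \<Rightarrow> ('v \<Rightarrow> mark) \<Rightarrow> bpoly" where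
  "weight \<Phi> J L a b g = (\<Prod>v\<in>L. cst (touch (a v) (b v) (g v)) * \<Phi> v (g v)) * cst (\<Prod>e\<in>{e \<in> J. e \<subseteq> L}. link_weight g e)"

text \<open>The partition function of the marking model on \<open>L\<close>. The parameters \<open>a\<close> and \<open>b\<close> record the decided
neighbours outside \<open>L\<close>. In this form deciding a vertex of \<open>L\<close> leads to sums of the same kind over a
smaller set (lemma \<open>linked_sum_insert\<close>).\<close>

definition linked_sum :: "('v \<Rightarrow> mark \<Rightarrow> bpoly) \<Rightarrow> 'v set set \<Rightarrow> 'v set \<Rightarrow> ('v \<Rightarrow> nat) \<Rightarrow> ('v \<Rightarrow> nat) \<Rightarrow> bpoly" where
  "linked_sum \<Phi> J L a b = (\<Sum>g\<in>L \<rightarrow>\<^sub>E UNIV. weight \<Phi> J L a b g)"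

lemma UNIV_mark: "(UNIV :: mark set) = {Neither, InY, InX}"
  using mark.exhaust by auto

lemma finite_UNIV_mark [simp]: "finite (UNIV :: mark set)"
  by (simp add: UNIV_mark)

lemma sum_mark_assignments_insert:
  fixes f :: "('v \<Rightarrow> mark) \<Rightarrow> 'r :: comm_monoid_add"
  assumes "v \<notin> L"
  shows "(\<Sum>g\<in>insert v L \<rightarrow>\<^sub>E UNIV. f g) = (\<Sum>g\<in>L \<rightarrow>\<^sub>E UNIV. f (g(v := Neither)))
     + (\<Sum>g\<in>L \<rightarrow>\<^sub>E UNIV. f (g(v := InY))) + (\<Sum>g\<in>L \<rightarrow>\<^sub>E UNIV. f (g(v := InX)))"
proof -
  have "(\<Sum>g\<in>insert v L \<rightarrow>\<^sub>E UNIV. f g) = (\<Sum>(s, g)\<in>UNIV \<times> (L \<rightarrow>\<^sub>E UNIV). f (g(v := s)))"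
    unfolding PiE_insert_eq
    by (subst sum.reindex) (use inj_combinator[OF assms, of "\<lambda>_. UNIV"] in \<open>auto simp: case_prod_unfold\<close>)
  also have "\<dots> = (\<Sum>s\<in>UNIV. \<Sum>g\<in>L \<rightarrow>\<^sub>E UNIV. f (g(v := s)))"
    by (simp add: sum.cartesian_product)
  finally show ?thesis by (simp add: UNIV_mark add.assoc)
qed

lemma touch_Suc:
  "touch (Suc a) b s = pair_weight InY s * touch a b s"
  "touch a (Suc b) s = pair_weight InX s * touch a b s"
  by (cases s; simp add: touch_def pair_weight_def)+

lemma prod_touch_link:
  assumes "finite L"
  shows "(\<Prod>u\<in>L. touch (a u + (if u \<in> N then 1 else 0)) (b u) (g u))
       = (\<Prod>u\<in>N \<inter> L. pair_weight InY (g u)) * (\<Prod>u\<in>L. touch (a u) (b u) (g u))"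
    and "(\<Prod>u\<in>L. touch (a u) (b u + (if u \<in> N then 1 else 0)) (g u))
       = (\<Prod>u\<in>N \<inter> L. pair_weight InX (g u)) * (\<Prod>u\<in>L. touch (a u) (b u) (g u))"
  using assms by (induction L) (auto simp: touch_Suc Int_insert_right)

lemma weight_insert:
  assumes L: "finite L" "v \<notin> L" and J: "\<forall>e\<in>J. card e = 2"
  shows "weight \<Phi> J (insert v L) a b (g(v := s)) =
    cst (touch (a v) (b v) s) * \<Phi> v s * (cst (\<Prod>u\<in>link J v \<inter> L. pair_weight s (g u)) * weight \<Phi> J L a b g)"
proof -
  have edges: "{e \<in> J. e \<subseteq> insert v L} = {e \<in> J. e \<subseteq> L} \<union> (\<lambda>u. {u, v}) ` (link J v \<inter> L)" (is "_ = ?A \<union> ?B")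
  proof (intro equalityI subsetI)
    fix e assume e: "e \<in> {e \<in> J. e \<subseteq> insert v L}"
    show "e \<in> ?A \<union> ?B"
    proof (cases "v \<in> e")
      case True
      with e J have "card e = 2" by auto
      with True obtain u where "e = {u, v}" "u \<noteq> v"
        by (auto simp: card_2_iff doubleton_eq_iff)
      with e show ?thesis by (auto simp: link_def)
    qed (use e in auto)
  qed (auto simp: link_def)
  have disj: "?A \<inter> ?B = {}" using L(2) by auto
  have finA: "finite ?A" by (rule finite_subset[of _ "Pow L"]) (use L in auto)
  have finB: "finite ?B" using L by auto
  have inj: "inj_on (\<lambda>u. {u, v}) (link J v \<inter> L)"
    using L(2) by (auto simp: inj_on_def doubleton_eq_iff)
  have "(\<Prod>e\<in>{e \<in> J. e \<subseteq> insert v L}. link_weight (g(v := s)) e)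
     = (\<Prod>e\<in>?A. link_weight (g(v := s)) e) * (\<Prod>u\<in>link J v \<inter> L. link_weight (g(v := s)) {u, v})"
    unfolding edges prod.union_disjoint[OF finA finB disj] prod.reindex[OF inj] by simp
  also have "(\<Prod>e\<in>?A. link_weight (g(v := s)) e) = (\<Prod>e\<in>?A. link_weight g e)"
    using L(2) by (intro prod.cong refl link_weight_cong) auto
  also have "(\<Prod>u\<in>link J v \<inter> L. link_weight (g(v := s)) {u, v}) = (\<Prod>u\<in>link J v \<inter> L. pair_weight s (g u))"
    using L(2) by (intro prod.cong) (auto simp: link_weight_pair pair_weight_def)
  finally have pr: "(\<Prod>e\<in>{e \<in> J. e \<subseteq> insert v L}. link_weight (g(v := s)) e)
     = (\<Prod>e\<in>?A. link_weight g e) * (\<Prod>u\<in>link J v \<inter> L. pair_weight s (g u))" .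
  have "(\<Prod>u\<in>L. cst (touch (a u) (b u) ((g(v := s)) u)) * \<Phi> u ((g(v := s)) u))
      = (\<Prod>u\<in>L. cst (touch (a u) (b u) (g u)) * \<Phi> u (g u))"
    using L(2) by (intro prod.cong) auto
  then show ?thesis
    unfolding weight_def pr using L by (simp add: cst_mult mult_ac)
qed

definition bump :: "('v \<Rightarrow> nat) \<Rightarrow> 'v set \<Rightarrow> 'v \<Rightarrow> nat" where
  "bump a N u = a u + (if u \<in> N then 1 else 0)"

lemma weight_bump:
  assumes "finite L"
  shows "weight \<Phi> J L (bump a N) b g = cst (\<Prod>u\<in>N \<inter> L. pair_weight InY (g u)) * weight \<Phi> J L a b g"
    and "weight \<Phi> J L a (bump b N) g = cst (\<Prod>u\<in>N \<inter> L. pair_weight InX (g u)) * weight \<Phi> J L a b g"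
  unfolding weight_def bump_def prod.distrib cst_prod[symmetric] prod_touch_link[OF assms]
  by (simp_all add: cst_mult mult_ac)

lemma linked_sum_insert:
  assumes "finite L" "v \<notin> L" "\<forall>e\<in>J. card e = 2"
  shows "linked_sum \<Phi> J (insert v L) a b = \<Phi> v Neither * linked_sum \<Phi> J L a b
     + cst (touch (a v) (b v) InY) * \<Phi> v InY * linked_sum \<Phi> J L (bump a (link J v)) b
     + cst (touch (a v) (b v) InX) * \<Phi> v InX * linked_sum \<Phi> J L a (bump b (link J v))"
  unfolding linked_sum_def sum_mark_assignments_insert[OF assms(2)] weight_insert[OF assms]
    weight_bump[OF assms(1)] sum_distrib_left[symmetric]
  by (simp add: touch_Neither pair_weight_Neither)

lemma linked_sum_cong:
  assumes "\<And>v. v \<in> L \<Longrightarrow> a v = a' v" "\<And>v. v \<in> L \<Longrightarrow> b v = b' v"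
  shows "linked_sum \<Phi> J L a b = linked_sum \<Phi> J L a' b'"
  unfolding linked_sum_def weight_def using assms by (intro sum.cong arg_cong2[where f = times] prod.cong) auto

lemma linked_sum_empty: "{} \<notin> J \<Longrightarrow> linked_sum \<Phi> J {} a b = 1"
proof -
  assume "{} \<notin> J"
  then have "{e \<in> J. e \<subseteq> {}} = {}" by auto
  then show ?thesis unfolding linked_sum_def weight_def by (simp only: prod.empty) simp
qed

section \<open>Schur positivity of linked sums\<close>

definition scaled :: "real \<Rightarrow> (mark \<Rightarrow> bpoly) \<Rightarrow> mark \<Rightarrow> bpoly" where
  "scaled c F = trio (cst c * F Neither) (F InY) (F InX)"

text \<open>What the induction requires of a vertex with at most \<open>j\<close> links. Its marked weights are dominated by
the fraction \<open>\<nu> / 2^j\<close> of its unmarked weight, where the power of two reflects that each link is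
halved at a marked end. The number \<open>\<rho>\<close> is the guaranteed growth of the partition function when the vertex is released. The
inequality \<open>1 + \<nu>/3 \<le> 2 \<rho>\<close> pays for deciding a vertex that a cluster touches, and \<open>\<nu>/3 \<le> \<rho>/2\<close>
enters only the refined estimate for a cluster that starts at a single vertex. The last
disjunction ensures growth: either \<open>\<nu>\<close> is small, or the two marked weights have a Schur
positive sum and only clusters with at least two vertices contribute negatively.\<close>

definition tame :: "real \<Rightarrow> real \<Rightarrow> nat \<Rightarrow> (mark \<Rightarrow> bpoly) \<Rightarrow> bool" where
  "tame \<nu> \<rho> j F \<longleftrightarrow> 0 \<le> \<nu> \<and> 0 < \<rho> \<and> 1 + \<nu> / 3 \<le> 2 * \<rho> \<and> \<nu> / 3 \<le> \<rho> / 2 \<and> F Neither \<in> schur_pos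
    \<and> (0 < j \<longrightarrow> dominated (scaled (\<nu> / 2 ^ j) F))
    \<and> (dominated (scaled (\<nu> / 2 ^ j) F) \<and> \<nu> \<le> 1 - \<rho> \<or> F InY + F InX \<in> schur_pos \<and> \<nu> * (1 - (3 / 4) ^ j) \<le> 1 - \<rho>)"

lemma schur_pos_weaken: "F + cst c * G \<in> schur_pos \<Longrightarrow> G \<in> schur_pos \<Longrightarrow> c \<le> c' \<Longrightarrow> F + cst c' * G \<in> schur_pos"
proof -
  assume a: "F + cst c * G \<in> schur_pos" "G \<in> schur_pos" "c \<le> c'"
  have "(F + cst c * G) + cst (c' - c) * G \<in> schur_pos"
    using a by (intro schur_pos_add[OF a(1)] schur_pos_mult schur_pos_cst) auto
  then show ?thesis by (simp add: cst_diff algebra_simps)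
qed

text \<open>A negative multiple of \<open>G\<close> can be charged to \<open>H\<close> when \<open>H\<close> contains \<open>r G\<close>.\<close>

lemma schur_pos_transfer:
  assumes "F + cst c * G \<in> schur_pos" "H - cst r * G \<in> schur_pos" "0 < r" "0 \<le> c" "c \<le> d * r" "H \<in> schur_pos"
  shows "F + cst d * H \<in> schur_pos"
proof -
  have "(F + cst c * G) + cst (c / r) * (H - cst r * G) \<in> schur_pos"
    using assms by (intro schur_pos_add[OF assms(1)] schur_pos_mult[OF schur_pos_cst assms(2)]) auto
  moreover have "cst (c / r) * cst r = cst c"
    using assms by (simp flip: cst_mult)
  ultimately have "F + cst (c / r) * H \<in> schur_pos"
    by (simp add: right_diff_distrib flip: mult.assoc)
  moreover have "c / r \<le> d" using assms by (simp add: field_simps)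
  ultimately show ?thesis by (rule schur_pos_weaken[OF _ assms(6)])
qed

locale linked_system =
  fixes \<Phi> :: "'v \<Rightarrow> mark \<Rightarrow> bpoly" and J :: "'v set set" and \<nu> \<rho> :: "'v \<Rightarrow> real" and j :: "'v \<Rightarrow> nat"
  assumes J: "\<forall>e\<in>J. card e = 2"
begin

abbreviation Z where "Z \<equiv> linked_sum \<Phi> J"
abbreviation untouched :: "'v \<Rightarrow> nat" where "untouched \<equiv> \<lambda>_. 0"
abbreviation nb :: "'v \<Rightarrow> 'v set" where "nb \<equiv> link J"

lemma link_sym: "u \<in> nb v \<longleftrightarrow> v \<in> nb u"
  by (simp add: link_def insert_commute)

lemma link_irrefl: "v \<notin> nb v"
proof
  assume "v \<in> nb v"
  then have "card {v, v} = 2" using J unfolding link_def by blast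
  then show False by simp
qed

text \<open>A cluster of marked vertices outside \<open>L\<close> has weights \<open>Q InY\<close> and \<open>Q InX\<close> in its two global
states and touches \<open>v\<close> through \<open>a v + b v\<close> links. Each of these links may cost a factor \<open>2\<close>.\<close>

definition controlled :: "'v set \<Rightarrow> bool" where
  "controlled L \<longleftrightarrow> (\<forall>a b Q. dominated Q \<and> (\<forall>v\<in>L. a v + b v + card (nb v \<inter> L) \<le> j v) \<longrightarrow>
      Q InY * Z L a b + Q InX * Z L b a + cst (2 ^ (\<Sum>v\<in>L. a v + b v)) * (Q Neither * Z L untouched untouched) \<in> schur_pos)"

definition growing :: "'v set \<Rightarrow> bool" where
  "growing L \<longleftrightarrow> Z L untouched untouched \<in> schur_pos \<and> (\<forall>v\<in>L. Z L untouched untouched - cst (\<rho> v) * (\<Phi> v Neither * Z (L - {v}) untouched untouched) \<in> schur_pos)"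

definition admissible :: "'v set \<Rightarrow> bool" where
  "admissible L \<longleftrightarrow> finite L \<and> (\<forall>v\<in>L. tame (\<nu> v) (\<rho> v) (j v) (\<Phi> v) \<and> card (nb v \<inter> L) \<le> j v)"

lemma admissible_subset: "admissible L \<Longrightarrow> K \<subseteq> L \<Longrightarrow> admissible K"
  unfolding admissible_def
  by (meson card_mono finite_Int finite_subset inf_mono order_refl order_trans subsetD)

lemma card_link_delete:
  assumes "finite L" "v \<in> L"
  shows "card (nb u \<inter> L) = card (nb u \<inter> (L - {v})) + (if v \<in> nb u then 1 else 0)"
proof (cases "v \<in> nb u")
  case True
  then have "nb u \<inter> L = insert v (nb u \<inter> (L - {v}))" using assms by auto
  then show ?thesis using assms True by simp
next
  case False
  then have "nb u \<inter> L = nb u \<inter> (L - {v})" by auto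
  then show ?thesis using False by simp
qed

lemma sum_bump: "finite L \<Longrightarrow> (\<Sum>u\<in>L. bump a N u + b u) = (\<Sum>u\<in>L. a u + b u) + card (N \<inter> L)"
  by (simp add: bump_def sum.distrib sum.If_cases Int_commute)

text \<open>Decide a vertex \<open>v\<close> that is touched by \<open>k\<close> links, all from equally marked neighbours. If \<open>v\<close> stays
unmarked, the cluster loses \<open>k\<close> touching links. Otherwise only the opposite mark is allowed, \<open>v\<close>
joins the cluster at the price \<open>\<nu> / 2^j * (2/3)^k\<close>, and the \<open>l \<le> j - k\<close> further links of \<open>v\<close> start
to touch. The two cases together cost at most \<open>1 + \<nu> / 3^k\<close>, while the factor \<open>2^k \<rho>\<close> becomes
available.\<close>

lemma controlled_step:
  assumes L: "finite L" "v \<in> L" and ad: "admissible L"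
    and ctl: "controlled (L - {v})" and mon: "growing L" "growing (L - {v})"
    and Q: "dominated Q" and inv: "\<forall>v\<in>L. a v + b v + card (nb v \<inter> L) \<le> j v"
    and touched: "a v = 0" "0 < b v"
  shows "Q InY * Z L a b + Q InX * Z L b a + cst (2 ^ (\<Sum>v\<in>L. a v + b v)) * (Q Neither * Z L untouched untouched) \<in> schur_pos"
proof -
  define L' where "L' = L - {v}"
  have L': "L = insert v L'" "v \<notin> L'" "finite L'" using L by (auto simp: L'_def)
  define k where "k = b v"
  define l where "l = card (nb v \<inter> L')"
  define t where "t = (\<Sum>u\<in>L'. a u + b u)"
  have kl: "k + l \<le> j v"
    using inv[rule_format, OF L(2)] touched card_link_delete[OF L, of v] link_irrefl[of v]
    unfolding k_def l_def L'_def by simp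
  have sumL: "(\<Sum>u\<in>L. a u + b u) = k + t"
    unfolding L'(1) using L'(2,3) touched by (simp add: k_def t_def)
  have tm: "tame (\<nu> v) (\<rho> v) (j v) (\<Phi> v)" using ad L(2) by (simp add: admissible_def)
  then have F0: "\<Phi> v Neither \<in> schur_pos" and \<nu>: "0 \<le> \<nu> v" and \<rho>: "0 < \<rho> v" "1 + \<nu> v / 3 \<le> 2 * \<rho> v"
    by (auto simp: tame_def)
  define \<mu> where "\<mu> = \<nu> v / 2 ^ j v"
  have dv: "dominated (scaled \<mu> (\<Phi> v))"
    using tm kl touched unfolding tame_def \<mu>_def k_def by auto
  have inv': "\<forall>u\<in>L'. a u + b u + card (nb u \<inter> L') \<le> j u"
    using inv card_link_delete[OF L] unfolding L'_def by fastforce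
  have inv'': "\<forall>u\<in>L'. bump a (nb v) u + b u + card (nb u \<inter> L') \<le> j u"
  proof
    fix u assume "u \<in> L'"
    then have "a u + b u + card (nb u \<inter> L) \<le> j u" using inv by (auto simp: L'_def)
    then show "bump a (nb v) u + b u + card (nb u \<inter> L') \<le> j u"
      unfolding card_link_delete[OF L, of u] L'_def[symmetric] bump_def using link_sym[of u v] by auto
  qed
  have Z0: "Z L' untouched untouched \<in> schur_pos" and Q0: "Q Neither \<in> schur_pos"
    using mon(2) dominated_Neither_schur_pos[OF Q] by (auto simp: growing_def L'_def)
  have 1: "Q InY * Z L' a b + Q InX * Z L' b a + cst (2 ^ t) * (Q Neither * Z L' untouched untouched) \<in> schur_pos"
    using ctl Q inv' unfolding controlled_def L'_def[symmetric] t_def by blast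
  have 2: "scaled \<mu> (\<Phi> v) InY * Q InY * Z L' (bump a (nb v)) b + scaled \<mu> (\<Phi> v) InX * Q InX * Z L' b (bump a (nb v))
     + cst (2 ^ (t + l)) * (scaled \<mu> (\<Phi> v) Neither * Q Neither * Z L' untouched untouched) \<in> schur_pos"
    using ctl dominated_mult[OF dv Q] inv''
    unfolding controlled_def L'_def[symmetric] t_def l_def sum_bump[OF L'(3), of a "nb v" b, symmetric] by blast
  define r :: real where "r = (2 / 3) ^ k"
  define G where "G = \<Phi> v Neither * (Q Neither * Z L' untouched untouched)"
  have G: "G \<in> schur_pos" unfolding G_def using F0 Q0 Z0 by (intro schur_pos_mult)
  have 3: "Q InY * Z L a b + Q InX * Z L b a + cst (2 ^ t + r * 2 ^ (t + l) * \<mu>) * G \<in> schur_pos"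
  proof -
    have "\<Phi> v Neither * (Q InY * Z L' a b + Q InX * Z L' b a + cst (2 ^ t) * (Q Neither * Z L' untouched untouched))
      + cst r * (scaled \<mu> (\<Phi> v) InY * Q InY * Z L' (bump a (nb v)) b + scaled \<mu> (\<Phi> v) InX * Q InX * Z L' b (bump a (nb v))
     + cst (2 ^ (t + l)) * (scaled \<mu> (\<Phi> v) Neither * Q Neither * Z L' untouched untouched)) \<in> schur_pos"
      by (rule schur_pos_add[OF schur_pos_mult[OF F0 1] schur_pos_mult[OF schur_pos_cst 2]]) (simp add: r_def)
    also have "\<Phi> v Neither * (Q InY * Z L' a b + Q InX * Z L' b a + cst (2 ^ t) * (Q Neither * Z L' untouched untouched))
      + cst r * (scaled \<mu> (\<Phi> v) InY * Q InY * Z L' (bump a (nb v)) b + scaled \<mu> (\<Phi> v) InX * Q InX * Z L' b (bump a (nb v))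
     + cst (2 ^ (t + l)) * (scaled \<mu> (\<Phi> v) Neither * Q Neither * Z L' untouched untouched))
     = Q InY * Z L a b + Q InX * Z L b a + cst (2 ^ t + r * 2 ^ (t + l) * \<mu>) * G"
      unfolding L'(1) linked_sum_insert[OF L'(3,2) J] G_def using touched
      by (simp add: touch_def scaled_def r_def k_def cst_add cst_mult algebra_simps)
    finally show ?thesis .
  qed
  have 4: "Q Neither * Z L untouched untouched - cst (\<rho> v) * G \<in> schur_pos"
  proof -
    have "Q Neither * (Z L untouched untouched - cst (\<rho> v) * (\<Phi> v Neither * Z L' untouched untouched)) \<in> schur_pos"
      using mon(1) L(2) Q0 unfolding growing_def L'_def by (intro schur_pos_mult) auto
    then show ?thesis by (simp add: G_def algebra_simps)
  qed
  have num: "2 ^ t + r * 2 ^ (t + l) * \<mu> \<le> 2 ^ (k + t) * \<rho> v"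
  proof -
    have k1: "1 \<le> k" using touched by (simp add: k_def)
    have "r * 2 ^ l * \<mu> \<le> \<nu> v / 3"
    proof -
      have "(2::real) ^ (k + l) \<le> 2 ^ j v" using kl by (intro power_increasing) auto
      then have "r * 2 ^ l * \<mu> \<le> r * 2 ^ l * (\<nu> v / 2 ^ (k + l))"
        unfolding \<mu>_def r_def using \<nu> by (intro mult_left_mono divide_left_mono) auto
      also have "\<dots> = \<nu> v * (1 / 3) ^ k"
        by (simp add: r_def power_add power_divide)
      also have "\<dots> \<le> \<nu> v * (1 / 3) ^ 1"
        using \<nu> k1 by (intro mult_left_mono power_decreasing) auto
      finally show ?thesis by simp
    qed
    then have "1 + r * 2 ^ l * \<mu> \<le> 2 ^ 1 * \<rho> v" using \<rho> by simp
    also have "\<dots> \<le> 2 ^ k * \<rho> v"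
      using \<rho> k1 by (intro mult_right_mono power_increasing) auto
    finally have "2 ^ t * (1 + r * 2 ^ l * \<mu>) \<le> 2 ^ t * (2 ^ k * \<rho> v)" by simp
    then show ?thesis by (simp add: power_add algebra_simps)
  qed
  show ?thesis
    unfolding sumL
  proof (rule schur_pos_transfer[OF 3 4 \<rho>(1) _ num])
    show "0 \<le> 2 ^ t + r * 2 ^ (t + l) * \<mu>" using \<nu> by (simp add: r_def \<mu>_def)
    show "Q Neither * Z L untouched untouched \<in> schur_pos" using Q0 mon(1) by (intro schur_pos_mult) (auto simp: growing_def)
  qed
qed

text \<open>An untouched set decouples from the cluster, whose two states are then compensated by domination. A
vertex touched from both sides must stay unmarked, which is the easy case.\<close>

lemma controlled_if:
  assumes ad: "admissible L" and mon: "\<And>K. K \<subseteq> L \<Longrightarrow> growing K"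
    and ctl: "\<And>K. K \<subset> L \<Longrightarrow> controlled K"
  shows "controlled L"
  unfolding controlled_def
proof (intro allI impI, elim conjE)
  fix a b Q
  assume Q: "dominated Q" and inv: "\<forall>v\<in>L. a v + b v + card (nb v \<inter> L) \<le> j v"
  have fin: "finite L" using ad by (simp add: admissible_def)
  have Q0: "Q Neither \<in> schur_pos" by (rule dominated_Neither_schur_pos[OF Q])
  show "Q InY * Z L a b + Q InX * Z L b a + cst (2 ^ (\<Sum>v\<in>L. a v + b v)) * (Q Neither * Z L untouched untouched) \<in> schur_pos"
  proof (cases "\<exists>v\<in>L. a v + b v \<noteq> 0")
    case False
    then have "Z L a b = Z L untouched untouched" "Z L b a = Z L untouched untouched" by (auto intro: linked_sum_cong)
    moreover have "(\<Sum>v\<in>L. a v + b v) = 0" using False by simp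
    moreover have "(Q Neither + Q InY + Q InX) * Z L untouched untouched \<in> schur_pos"
      using dominated_sum_schur_pos[OF Q] mon[of L] by (intro schur_pos_mult) (auto simp: growing_def)
    ultimately show ?thesis by (simp add: algebra_simps)
  next
    case True
    then obtain v where v: "v \<in> L" "a v + b v \<noteq> 0" by auto
    have sub: "L - {v} \<subset> L" using v by auto
    note step = controlled_step[OF fin v(1) ad ctl[OF sub] mon mon[of "L - {v}"]]
    show ?thesis
    proof (cases "a v = 0 \<or> b v = 0")
      case True
      then show ?thesis
      proof
        assume "a v = 0"
        then show ?thesis using step[of Q a b] Q inv v by auto
      next
        assume "b v = 0"
        then have "trio (Q Neither) (Q InX) (Q InY) InY * Z L b a + trio (Q Neither) (Q InX) (Q InY) InX * Z L a b
           + cst (2 ^ (\<Sum>v\<in>L. b v + a v)) * (trio (Q Neither) (Q InX) (Q InY) Neither * Z L untouched untouched) \<in> schur_pos"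
          using dominated_swap[OF Q] inv v by (intro step) (auto simp: add_ac)
        then show ?thesis by (simp add: add_ac)
      qed
    next
      case False
      define L' where "L' = L - {v}"
      have L': "L = insert v L'" "v \<notin> L'" "finite L'" using v fin by (auto simp: L'_def)
      have inv': "\<forall>u\<in>L'. a u + b u + card (nb u \<inter> L') \<le> j u"
        using inv card_link_delete[OF fin v(1)] unfolding L'_def by fastforce
      define t where "t = (\<Sum>u\<in>L'. a u + b u)"
      have sumL: "(\<Sum>u\<in>L. a u + b u) = a v + b v + t"
        unfolding L'(1) using L'(2,3) by (simp add: t_def)
      have tm: "tame (\<nu> v) (\<rho> v) (j v) (\<Phi> v)" using ad v by (simp add: admissible_def)
      then have F0: "\<Phi> v Neither \<in> schur_pos" and \<rho>: "0 < \<rho> v" "1 \<le> 2 * \<rho> v"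
        by (auto simp: tame_def)
      have 1: "Q InY * Z L' a b + Q InX * Z L' b a + cst (2 ^ t) * (Q Neither * Z L' untouched untouched) \<in> schur_pos"
        using ctl[OF sub] Q inv' unfolding controlled_def L'_def[symmetric] t_def by blast
      have 2: "Q InY * Z L a b + Q InX * Z L b a + cst (2 ^ t) * (\<Phi> v Neither * (Q Neither * Z L' untouched untouched)) \<in> schur_pos"
        using schur_pos_mult[OF F0 1] False unfolding L'(1) linked_sum_insert[OF L'(3,2) J]
        by (simp add: touch_def algebra_simps)
      have 3: "Q Neither * Z L untouched untouched - cst (\<rho> v) * (\<Phi> v Neither * (Q Neither * Z L' untouched untouched)) \<in> schur_pos"
      proof -
        have "Q Neither * (Z L untouched untouched - cst (\<rho> v) * (\<Phi> v Neither * Z L' untouched untouched)) \<in> schur_pos"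
          using mon[of L] v Q0 unfolding growing_def L'_def by (intro schur_pos_mult) auto
        then show ?thesis by (simp add: algebra_simps)
      qed
      have 4: "(2::real) ^ t \<le> 2 ^ (a v + b v + t) * \<rho> v"
      proof -
        have "(2::real) ^ 1 * \<rho> v \<le> 2 ^ (a v + b v) * \<rho> v"
          using \<rho> v(2) by (intro mult_right_mono power_increasing) auto
        then have "1 \<le> 2 ^ (a v + b v) * \<rho> v" using \<rho> unfolding power_one_right by linarith
        then have "(2::real) ^ t * 1 \<le> 2 ^ t * (2 ^ (a v + b v) * \<rho> v)" by (intro mult_left_mono) auto
        then show ?thesis by (simp add: power_add algebra_simps)
      qed
      have 5: "Q Neither * Z L untouched untouched \<in> schur_pos" using Q0 mon[of L] by (intro schur_pos_mult) (auto simp: growing_def)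
      show ?thesis
        unfolding sumL by (rule schur_pos_transfer[OF 2 3 \<rho>(1) _ 4 5]) simp
    qed
  qed
qed

text \<open>A refinement of \<open>controlled\<close> for clusters whose two states have a Schur positive sum. As long as no
further vertex joins, such a cluster does no harm, so with \<open>t\<close> touching links the cost is not \<open>2^t\<close>
but \<open>(1 - (3/4)^t) 2^t\<close>: the factor \<open>s t = 1 - (3/4)^t\<close> satisfies \<open>s (t - 1) + \<nu>/3 \<le> 2 \<rho> * s t\<close>.\<close>

lemma root_bound:
  assumes "admissible L" and "\<And>K. K \<subseteq> L \<Longrightarrow> growing K \<and> controlled K"
    and "dominated Q" "Q InY + Q InX \<in> schur_pos"
    and "\<forall>v\<in>L. a v + card (nb v \<inter> L) \<le> j v" "\<forall>v\<in>L. a v \<le> 1"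
  shows "Q InY * Z L a untouched + Q InX * Z L untouched a
    + cst ((1 - (3 / 4) ^ (\<Sum>v\<in>L. a v)) * 2 ^ (\<Sum>v\<in>L. a v)) * (Q Neither * Z L untouched untouched) \<in> schur_pos"
  using assms
proof (induction "card L" arbitrary: L rule: less_induct)
  case less
  note ad = less.prems(1) and IHs = less.prems(2) and Q = less.prems(3,4) and inv = less.prems(5,6)
  have fin: "finite L" using ad by (simp add: admissible_def)
  have Q0: "Q Neither \<in> schur_pos" by (rule dominated_Neither_schur_pos[OF Q(1)])
  show ?case
  proof (cases "\<exists>v\<in>L. a v \<noteq> 0")
    case False
    then have "Z L a untouched = Z L untouched untouched" "Z L untouched a = Z L untouched untouched" by (auto intro: linked_sum_cong)
    moreover have "(Q InY + Q InX) * Z L untouched untouched \<in> schur_pos"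
      using Q IHs[of L] by (intro schur_pos_mult) (auto simp: growing_def)
    ultimately show ?thesis using False by (simp add: algebra_simps)
  next
    case True
    then obtain v where v: "v \<in> L" "a v = 1" using inv(2) by force
    define L' where "L' = L - {v}"
    have L': "L = insert v L'" "v \<notin> L'" "finite L'" "L' \<subseteq> L" using v fin by (auto simp: L'_def)
    define l where "l = card (nb v \<inter> L')"
    define t where "t = (\<Sum>u\<in>L'. a u)"
    have lj: "l + 1 \<le> j v"
      using inv(1)[rule_format, OF v(1)] v(2) card_link_delete[OF fin v(1), of v] link_irrefl[of v]
      unfolding l_def L'_def by simp
    have sumL: "(\<Sum>u\<in>L. a u) = t + 1"
      unfolding L'(1) using L'(2,3) v(2) by (simp add: t_def)
    have tm: "tame (\<nu> v) (\<rho> v) (j v) (\<Phi> v)" using ad v(1) by (simp add: admissible_def)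
    then have F0: "\<Phi> v Neither \<in> schur_pos" and \<nu>: "0 \<le> \<nu> v"
      and \<rho>: "0 < \<rho> v" "1 + \<nu> v / 3 \<le> 2 * \<rho> v" "\<nu> v / 3 \<le> \<rho> v / 2"
      by (auto simp: tame_def)
    define \<mu> where "\<mu> = \<nu> v / 2 ^ j v"
    have dv: "dominated (scaled \<mu> (\<Phi> v))"
      using tm lj unfolding tame_def \<mu>_def by auto
    have inv': "\<forall>u\<in>L'. a u + card (nb u \<inter> L') \<le> j u" "\<forall>u\<in>L'. a u \<le> 1"
      using inv card_link_delete[OF fin v(1)] unfolding L'_def by fastforce+
    have inv'': "\<forall>u\<in>L'. bump untouched (nb v) u + a u + card (nb u \<inter> L') \<le> j u"
    proof
      fix u assume "u \<in> L'"
      then have "a u + card (nb u \<inter> L) \<le> j u" using inv by (auto simp: L'_def)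
      then show "bump untouched (nb v) u + a u + card (nb u \<inter> L') \<le> j u"
        unfolding card_link_delete[OF fin v(1), of u] L'_def[symmetric] bump_def using link_sym[of u v] by auto
    qed
    have 1: "Q InY * Z L' a untouched + Q InX * Z L' untouched a
      + cst ((1 - (3 / 4) ^ t) * 2 ^ t) * (Q Neither * Z L' untouched untouched) \<in> schur_pos"
      unfolding t_def
    proof (rule less.hyps)
      show "card L' < card L" using L' by simp
      show "admissible L'" using ad L'(4) by (rule admissible_subset)
    qed (use IHs L'(4) Q inv' in \<open>auto dest: subset_trans\<close>)
    \<comment> \<open>the joining vertex carries the opposite mark, hence the swap\<close>
    define S where "S = trio (Q Neither) (Q InX) (Q InY)"
    have "controlled L'" using IHs L'(4) by blast
    then have 2: "(scaled \<mu> (\<Phi> v) InY * S InY) * Z L' (bump untouched (nb v)) a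
      + (scaled \<mu> (\<Phi> v) InX * S InX) * Z L' a (bump untouched (nb v))
      + cst (2 ^ (t + l)) * ((scaled \<mu> (\<Phi> v) Neither * S Neither) * Z L' untouched untouched) \<in> schur_pos"
      using dominated_mult[OF dv dominated_swap[OF Q(1)]] inv'' sum_bump[OF L'(3), of untouched "nb v" a]
      unfolding controlled_def t_def l_def S_def by fastforce
    define G where "G = \<Phi> v Neither * (Q Neither * Z L' untouched untouched)"
    define c :: real where "c = (1 - (3 / 4) ^ t) * 2 ^ t"
    define d :: real where "d = 2 ^ (t + l)"
    define q :: real where "q = 2 / 3"
    have tq: "touch (a v) 0 InY = 0" "touch (a v) 0 InX = q" "touch 0 (a v) InY = q" "touch 0 (a v) InX = 0"
      using v(2) by (simp_all add: touch_def q_def)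
    have 3: "Q InY * Z L a untouched + Q InX * Z L untouched a
       + cst (c + q * d * \<mu>) * G \<in> schur_pos"
    proof -
      have "\<Phi> v Neither * (Q InY * Z L' a untouched + Q InX * Z L' untouched a
          + cst c * (Q Neither * Z L' untouched untouched))
        + cst q * ((scaled \<mu> (\<Phi> v) InY * S InY) * Z L' (bump untouched (nb v)) a
          + (scaled \<mu> (\<Phi> v) InX * S InX) * Z L' a (bump untouched (nb v))
          + cst d * ((scaled \<mu> (\<Phi> v) Neither * S Neither) * Z L' untouched untouched)) \<in> schur_pos"
        by (rule schur_pos_add[OF schur_pos_mult[OF F0 1[folded c_def]] schur_pos_mult[OF schur_pos_cst 2[folded d_def]]]) (simp add: q_def)
      also have "\<Phi> v Neither * (Q InY * Z L' a untouched + Q InX * Z L' untouched a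
          + cst c * (Q Neither * Z L' untouched untouched))
        + cst q * ((scaled \<mu> (\<Phi> v) InY * S InY) * Z L' (bump untouched (nb v)) a
          + (scaled \<mu> (\<Phi> v) InX * S InX) * Z L' a (bump untouched (nb v))
          + cst d * ((scaled \<mu> (\<Phi> v) Neither * S Neither) * Z L' untouched untouched))
        = Q InY * Z L a untouched + Q InX * Z L untouched a
          + cst (c + q * d * \<mu>) * G"
        unfolding L'(1) linked_sum_insert[OF L'(3,2) J] G_def by (simp add: tq scaled_def S_def cst_add cst_mult algebra_simps)
      finally show ?thesis .
    qed
    have 4: "Q Neither * Z L untouched untouched - cst (\<rho> v) * G \<in> schur_pos"
    proof -
      have "Q Neither * (Z L untouched untouched - cst (\<rho> v) * (\<Phi> v Neither * Z L' untouched untouched)) \<in> schur_pos"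
        using IHs[of L] v(1) Q0 unfolding growing_def L'_def by (intro schur_pos_mult) auto
      then show ?thesis by (simp add: G_def algebra_simps)
    qed
    have num: "(1 - (3 / 4) ^ t) * 2 ^ t + 2 / 3 * 2 ^ (t + l) * \<mu> \<le> (1 - (3 / 4) ^ (t + 1)) * 2 ^ (t + 1) * \<rho> v"
    proof -
      define r :: real where "r = (3 / 4) ^ t"
      have r: "0 \<le> r" "r \<le> 1" by (auto simp: r_def power_le_one)
      have "(2::real) ^ (l + 1) \<le> 2 ^ j v" using lj by (intro power_increasing) auto
      then have "2 / 3 * 2 ^ l * \<mu> \<le> 2 / 3 * 2 ^ l * (\<nu> v / 2 ^ (l + 1))"
        unfolding \<mu>_def using \<nu> by (intro mult_left_mono divide_left_mono) auto
      also have "\<dots> = \<nu> v / 3" by simp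
      finally have a: "(1 - r) + 2 / 3 * 2 ^ l * \<mu> \<le> 1 - r + \<nu> v / 3" by simp
      \<comment> \<open>a convex combination of the two numerical conditions, with weights \<open>1 - r\<close> and \<open>r\<close>\<close>
      also have "\<dots> = (1 - r) * (1 + \<nu> v / 3) + r * (\<nu> v / 3)"
      proof -
        have "1 - r + q = (1 - r) * (1 + q) + r * q" for q :: real by (simp add: algebra_simps)
        then show ?thesis .
      qed
      also have "\<dots> \<le> (1 - r) * (2 * \<rho> v) + r * (\<rho> v / 2)"
        using \<rho> r by (intro add_mono mult_left_mono) auto
      also have "\<dots> = (1 - (3 / 4) * r) * 2 * \<rho> v" by (simp add: algebra_simps)
      finally have "2 ^ t * ((1 - r) + 2 / 3 * 2 ^ l * \<mu>) \<le> 2 ^ t * ((1 - (3 / 4) * r) * 2 * \<rho> v)" by simp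
      then show ?thesis unfolding power_add r_def[symmetric] by (simp add: algebra_simps)
    qed
    show ?thesis
      unfolding sumL
    proof (rule schur_pos_transfer[OF 3[unfolded c_def d_def q_def] 4 \<rho>(1) _ num])
      show "0 \<le> (1 - (3 / 4) ^ t) * 2 ^ t + 2 / 3 * 2 ^ (t + l) * \<mu>"
        using \<nu> by (simp add: \<mu>_def power_le_one)
      show "Q Neither * Z L untouched untouched \<in> schur_pos" using Q0 IHs[of L] by (intro schur_pos_mult) (auto simp: growing_def)
    qed
  qed
qed

end

context linked_system
begin

text \<open>Releasing \<open>v\<close> adds the markings with \<open>v\<close> marked, that is, the clusters that start at \<open>v\<close>. They are
bounded by \<open>controlled\<close> or, if the marked weights of \<open>v\<close> are Schur positive together, by \<open>root_bound\<close>.\<close>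

lemma growing_insert:
  assumes ad: "admissible (insert v L)" and v: "v \<notin> L"
    and IH: "\<And>K. K \<subseteq> L \<Longrightarrow> growing K \<and> controlled K"
  shows "Z (insert v L) untouched untouched - cst (\<rho> v) * (\<Phi> v Neither * Z L untouched untouched) \<in> schur_pos"
proof -
  have fin: "finite L" using ad by (simp add: admissible_def)
  have adL: "admissible L" using ad by (rule admissible_subset) auto
  define a where "a = bump (\<lambda>_. 0) (nb v)"
  define t where "t = card (nb v \<inter> L)"
  have sum_a: "(\<Sum>u\<in>L. a u) = t"
    using sum_bump[OF fin, of "\<lambda>_. 0" "nb v" "\<lambda>_. 0"] by (simp add: a_def t_def)
  have inv: "\<forall>u\<in>L. a u + card (nb u \<inter> L) \<le> j u"
  proof
    fix u assume u: "u \<in> L"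
    then have "card (nb u \<inter> insert v L) \<le> j u" using ad by (simp add: admissible_def)
    moreover have "card (nb u \<inter> insert v L) = card (nb u \<inter> L) + (if v \<in> nb u then 1 else 0)"
      using v fin by (auto simp: Int_insert_right)
    ultimately show "a u + card (nb u \<inter> L) \<le> j u"
      using link_sym[of u v] by (simp add: a_def bump_def split: if_splits)
  qed
  have tj: "t \<le> j v"
    using ad link_irrefl[of v] by (simp add: admissible_def t_def)
  have tm: "tame (\<nu> v) (\<rho> v) (j v) (\<Phi> v)" using ad by (simp add: admissible_def)
  then have F0: "\<Phi> v Neither \<in> schur_pos" and \<nu>: "0 \<le> \<nu> v" by (auto simp: tame_def)
  have Z0: "Z L untouched untouched \<in> schur_pos" using IH[of L] by (simp add: growing_def)
  define \<mu> where "\<mu> = \<nu> v / 2 ^ j v"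
  have pj: "(2::real) ^ t \<le> 2 ^ j v" using tj by (intro power_increasing) auto
  define G where "G = \<Phi> v Neither * Z L untouched untouched"
  have G: "G \<in> schur_pos" unfolding G_def using F0 Z0 by (rule schur_pos_mult)
  define W where "W = \<Phi> v InY * Z L a untouched + \<Phi> v InX * Z L untouched a"
  have W: "W + cst (1 - \<rho> v) * G \<in> schur_pos"
  proof (cases "dominated (scaled \<mu> (\<Phi> v)) \<and> \<nu> v \<le> 1 - \<rho> v")
    case True
    have "controlled L" using IH by blast
    then have "scaled \<mu> (\<Phi> v) InY * Z L a untouched + scaled \<mu> (\<Phi> v) InX * Z L untouched a
        + cst (2 ^ t) * (scaled \<mu> (\<Phi> v) Neither * Z L untouched untouched) \<in> schur_pos"
      using True inv unfolding controlled_def sum_a[symmetric]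
      by (elim allE[of _ a] allE[of _ untouched] allE[of _ "scaled \<mu> (\<Phi> v)"]) simp
    then have "W + cst (2 ^ t * \<mu>) * G \<in> schur_pos"
      by (simp add: scaled_def W_def G_def cst_mult mult.assoc)
    moreover have "2 ^ t * \<mu> \<le> 1 - \<rho> v"
    proof -
      have "2 ^ t * \<mu> \<le> 2 ^ j v * \<mu>" using pj \<nu> by (intro mult_right_mono) (auto simp: \<mu>_def)
      then show ?thesis using True by (simp add: \<mu>_def)
    qed
    ultimately show ?thesis by (rule schur_pos_weaken[OF _ G])
  next
    case False
    then have S: "\<Phi> v InY + \<Phi> v InX \<in> schur_pos" and num: "\<nu> v * (1 - (3 / 4) ^ j v) \<le> 1 - \<rho> v"
      using tm unfolding tame_def \<mu>_def by auto
    show ?thesis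
    proof (cases "j v = 0")
      case True
      then have "nb v \<inter> L = {}" using tj fin unfolding t_def by simp
      then have "Z L a untouched = Z L untouched untouched" "Z L untouched a = Z L untouched untouched"
        by (auto intro!: linked_sum_cong simp: a_def bump_def)
      then have "W = (\<Phi> v InY + \<Phi> v InX) * Z L untouched untouched" by (simp add: W_def algebra_simps)
      moreover have "0 \<le> 1 - \<rho> v" using num True by simp
      ultimately show ?thesis by (simp add: schur_pos_add schur_pos_mult S Z0 G schur_pos_cst)
    next
      case j: False
      then have "dominated (scaled \<mu> (\<Phi> v))" using tm by (auto simp: tame_def \<mu>_def)
      then have "scaled \<mu> (\<Phi> v) InY * Z L a untouched + scaled \<mu> (\<Phi> v) InX * Z L untouched a
        + cst ((1 - (3 / 4) ^ t) * 2 ^ t) * (scaled \<mu> (\<Phi> v) Neither * Z L untouched untouched) \<in> schur_pos"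
        unfolding sum_a[symmetric] using S inv IH
        by (intro root_bound[OF adL]) (auto simp: scaled_def a_def bump_def)
      then have "W + cst ((1 - (3 / 4) ^ t) * 2 ^ t * \<mu>) * G \<in> schur_pos"
        by (simp add: scaled_def W_def G_def cst_mult mult.assoc)
      moreover have "(1 - (3 / 4) ^ t) * 2 ^ t * \<mu> \<le> 1 - \<rho> v"
      proof -
        have "((3::real) / 4) ^ j v \<le> (3 / 4) ^ t" using tj by (intro power_decreasing) auto
        then have "(1 - (3 / 4) ^ t) * 2 ^ t * \<mu> \<le> (1 - (3 / 4) ^ j v) * 2 ^ j v * \<mu>"
          using pj \<nu> by (intro mult_right_mono mult_mono) (auto simp: \<mu>_def power_le_one)
        also have "\<dots> = \<nu> v * (1 - (3 / 4) ^ j v)" by (simp add: \<mu>_def)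
        finally show ?thesis using num by simp
      qed
      ultimately show ?thesis by (rule schur_pos_weaken[OF _ G])
    qed
  qed
  have "Z (insert v L) untouched untouched - cst (\<rho> v) * G = W + cst (1 - \<rho> v) * G"
    unfolding linked_sum_insert[OF fin v J] W_def G_def a_def
    by (simp add: touch_def cst_diff algebra_simps)
  then show ?thesis using W by (simp add: G_def)
qed

lemma growing_and_controlled:
  assumes "admissible L"
  shows "growing L \<and> controlled L"
  using assms
proof (induction "card L" arbitrary: L rule: less_induct)
  case less
  have fin: "finite L" using less.prems by (simp add: admissible_def)
  have IH: "growing K \<and> controlled K" if "K \<subset> L" for K
    using less.hyps[OF psubset_card_mono[OF fin that]] admissible_subset[OF less.prems] that by blast
  have step: "Z L untouched untouched - cst (\<rho> v) * (\<Phi> v Neither * Z (L - {v}) untouched untouched) \<in> schur_pos"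
    if v: "v \<in> L" for v
  proof -
    have L: "insert v (L - {v}) = L" using v by auto
    have "Z (insert v (L - {v})) untouched untouched
      - cst (\<rho> v) * (\<Phi> v Neither * Z (L - {v}) untouched untouched) \<in> schur_pos"
    proof (rule growing_insert)
      show "admissible (insert v (L - {v}))" unfolding L by (rule less.prems)
    next
      fix K assume "K \<subseteq> L - {v}"
      then have "K \<subset> L" using v by auto
      then show "growing K \<and> controlled K" by (rule IH)
    qed simp
    then show ?thesis unfolding L .
  qed
  have "Z L untouched untouched \<in> schur_pos"
  proof (cases "L = {}")
    case True
    have "{} \<notin> J" using J by auto
    then show ?thesis unfolding True by (simp add: linked_sum_empty schur_pos_one)
  next
    case False
    then obtain v where v: "v \<in> L" by blast
    then have "tame (\<nu> v) (\<rho> v) (j v) (\<Phi> v)" using less.prems by (simp add: admissible_def)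
    then have "cst (\<rho> v) * (\<Phi> v Neither * Z (L - {v}) untouched untouched) \<in> schur_pos"
      using IH[of "L - {v}"] v by (intro schur_pos_mult schur_pos_cst) (auto simp: tame_def growing_def)
    from schur_pos_add[OF step[OF v] this] show ?thesis by simp
  qed
  then have mon: "growing L" using step by (simp add: growing_def)
  moreover have "controlled L"
  proof (rule controlled_if[OF less.prems])
    fix K assume "K \<subseteq> L"
    then show "growing K" using mon IH by (cases "K = L") auto
  qed (use IH in blast)
  ultimately show ?case ..
qed

corollary linked_sum_schur_pos: "admissible L \<Longrightarrow> Z L untouched untouched \<in> schur_pos"
  using growing_and_controlled[of L] unfolding growing_def by blast

end

section \<open>The weight of a vertex\<close>

text \<open>The factors of the weight of a vertex as functions of its mark: the vertex itself, the pendant leaf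
that it receives from an incident edge (and that it excludes when it is chosen), twice the uncoupled
part of an edge, an edge whose other end is in both sets, and a link.\<close>

definition base_factor :: "mark \<Rightarrow> bpoly" where
  "base_factor = trio 1 Y X"
definition leaf_factor :: "mark \<Rightarrow> bpoly" where
  "leaf_factor = trio ((1 + X) * (1 + Y)) (1 + X) (1 + Y)"
definition free_factor :: "mark \<Rightarrow> bpoly" where
  "free_factor = trio (1 + 3 * e1 + 3 * e2) ((1 + 3 * X) * (1 + Y)) ((1 + X) * (1 + 3 * Y))"
definition half_factor :: "mark \<Rightarrow> bpoly" where
  "half_factor = trio ((1 + 2 * X) * (1 + 2 * Y)) ((1 + 2 * X) * (1 + Y)) ((1 + X) * (1 + 2 * Y))"
definition link_factor :: "mark \<Rightarrow> bpoly" where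
  "link_factor = trio 1 (cst (1 / 2)) (cst (1 / 2))"

definition site :: "nat \<Rightarrow> nat \<Rightarrow> nat \<Rightarrow> nat \<Rightarrow> mark \<Rightarrow> bpoly" where
  "site l p q j s = base_factor s * leaf_factor s ^ l * free_factor s ^ p * half_factor s ^ q * link_factor s ^ j"

lemma dominated_unit: "dominated (trio 1 1 1)"
  using dominated_selection[of 0 0 0 0 0] by simp

lemma dominated_one_slack: "dominated (trio 1 0 0)"
  using dominated_slack[of 0 0] by simp

lemma dominated_left: "dominated (trio e1 X Y)"
  using dominated_selection[of 0 1 0 0 0] by simp

lemma dominated_right: "dominated (trio e1 Y X)"
  using dominated_selection[of 0 0 1 0 0] by simp

lemma dominated_e1: "dominated (trio e1 e1 e1)"
  using dominated_selection[of 0 0 0 0 1] by simp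

lemma dominated_e2: "dominated (trio e2 e2 e2)"
  using dominated_selection[of 1 0 0 0 0] by simp

lemma dominated_cross: "dominated (trio (e1 ^ 2) (2 * e2) (2 * e2))"
  using dominated_selection[of 0 0 0 1 0] by (simp add: numeral_2_eq_2)

lemma dominated_e2_left: "dominated (trio (e2 * e1) (e2 * X) (e2 * Y))"
  using dominated_selection[of 1 1 0 0 0] by simp

lemma dominated_e2_left_left: "dominated (trio (e2 * e1 ^ 2) (e2 * X ^ 2) (e2 * Y ^ 2))"
  using dominated_selection[of 1 2 0 0 0] by simp

lemma dominated_cross_left: "dominated (trio (e1 ^ 3) (2 * e2 * X) (2 * e2 * Y))"
  using dominated_selection[of 0 1 0 1 0] by (simp add: numeral_3_eq_3 mult_ac)

lemma dominated_power: "dominated F \<Longrightarrow> dominated (\<lambda>s. F s ^ n)"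
proof (induction n)
  case 0
  show ?case by (rule dominated_eq[OF dominated_unit]) (rule mark_fun_eqI; simp)
next
  case (Suc n)
  then show ?case using dominated_mult by simp
qed

lemma dominated_leaf_factor: "dominated leaf_factor"
  by (rule dominated_eq[OF dominated_add[OF dominated_unit dominated_add[OF dominated_left
       dominated_mult[OF dominated_e2 dominated_one_slack]]]])
    (rule mark_fun_eqI; simp add: leaf_factor_def algebra_simps)

lemma dominated_free_factor: "dominated free_factor"
proof -
  have "dominated (\<lambda>s. trio 1 1 1 s + (trio e1 e1 e1 s + (cst 2 * trio e1 X Y s + cst 3 * trio e2 e2 e2 s)))"
    by (intro dominated_add dominated_scale dominated_unit dominated_e1 dominated_left dominated_e2) auto
  then show ?thesis
    by (rule dominated_eq) (rule mark_fun_eqI; simp add: free_factor_def algebra_simps)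
qed

lemma dominated_half_factor: "dominated half_factor"
proof -
  have "dominated (\<lambda>s. trio 1 1 1 s + (trio e1 e1 e1 s + (trio e1 X Y s
      + (cst 2 * trio e2 e2 e2 s + cst 2 * trio (e2 ^ 1 * e1 ^ 0) 0 0 s))))"
    by (intro dominated_add dominated_scale dominated_unit dominated_e1 dominated_left dominated_e2 dominated_slack) auto
  then show ?thesis
    by (rule dominated_eq) (rule mark_fun_eqI; simp add: half_factor_def algebra_simps)
qed

text \<open>The next three lemmas give explicit certificates. A marked vertex of degree \<open>l\<close> has the weight
\<open>Y (1 + X)^l\<close>. Its monomials \<open>X^i Y\<close> are matched with selections from the monomials
\<open>(X + Y)^r (XY)^t\<close> of \<open>((1 + X) (1 + Y))^l\<close> with \<open>r + 2 t = i + 1\<close>, which amounts to replacing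
the vertex by one of its leaves. The fractions \<open>1\<close>, \<open>1/2\<close> and \<open>3/8\<close> suffice for \<open>l = 1, 2, 3\<close>; higher degrees reduce to \<open>l = 3\<close> since the leaf factor is itself dominated.\<close>

lemma dominated_base_1: "dominated (scaled 1 (\<lambda>s. base_factor s * leaf_factor s))"
proof -
  have "dominated (\<lambda>s. trio 1 0 0 s + (trio e1 Y X s + trio e2 e2 e2 s))"
    by (intro dominated_add dominated_one_slack dominated_right dominated_e2)
  then show ?thesis
    by (rule dominated_eq) (rule mark_fun_eqI; simp add: scaled_def base_factor_def leaf_factor_def algebra_simps)
qed

lemma dominated_base_2: "dominated (scaled (1 / 2) (\<lambda>s. base_factor s * leaf_factor s ^ 2))"
proof -
  have "dominated (\<lambda>s. cst (1 / 2) * trio 1 0 0 s + (trio e1 Y X s + (cst (1 / 2) * trio (e1 ^ 2) (2 * e2) (2 * e2) s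
     + (trio e2 e2 e2 s + (trio (e2 * e1) (e2 * X) (e2 * Y) s + cst (1 / 2) * trio (e2 ^ 2 * e1 ^ 0) 0 0 s)))))"
    by (intro dominated_add dominated_scale dominated_one_slack dominated_right
        dominated_cross dominated_e2_left dominated_e2 dominated_slack) auto
  moreover have "cst (1 / 2) * 2 = 1"
    using cst_mult[of "1 / 2" 2] by simp
  ultimately show ?thesis
    by (elim dominated_eq, intro mark_fun_eqI; simp add: scaled_def base_factor_def leaf_factor_def; algebra)
qed

lemma dominated_base_3: "dominated (scaled (3 / 8) (\<lambda>s. base_factor s * leaf_factor s ^ 3))"
proof -
  define h where "h = cst (1 / 16)"
  have h: "16 * h = 1"
    using cst_mult[of 16 "1 / 16"] by (simp add: h_def)
  have h': "h * (16 * Q) = Q" for Q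
    using h by (metis mult.assoc mult.commute mult_1)
  have c: "cst (3 / 8) = 6 * h"
    using cst_mult[of 6 "1 / 16"] by (simp add: h_def)
  let ?sl = "\<lambda>m n. trio (e2 ^ m * e1 ^ n) (0::bpoly) (0::bpoly)"
  let ?n = "\<lambda>k F (s::mark). (cst k * h) * (F s :: bpoly)"
  have sc: "dominated (?n k F)" if "0 \<le> k" "dominated F" for k F
    using dominated_scale[of "k * (1 / 16)" F] that by (simp only: h_def cst_mult)
  have "dominated (\<lambda>s. ?n 6 (?sl 0 0) s + (?n 16 (trio e1 Y X) s + (?n 2 (?sl 0 1) s
      + (?n 18 (trio e2 e2 e2) s + (?n 15 (trio (e1 ^ 2) (2 * e2) (2 * e2)) s + (?n 3 (?sl 0 2) s
      + (?n 36 (trio (e2 * e1) (e2 * X) (e2 * Y)) s + (?n 6 (trio (e1 ^ 3) (2 * e2 * X) (2 * e2 * Y)) s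
      + (?n 16 (trio (e2 * e1 ^ 2) (e2 * X ^ 2) (e2 * Y ^ 2)) s + (?n 2 (?sl 1 2) s
      + (?n 18 (?sl 2 0) s + (?n 18 (?sl 2 1) s + ?n 6 (?sl 3 0) s))))))))))))"
    by (intro dominated_add sc dominated_right dominated_cross dominated_cross_left
        dominated_e2 dominated_e2_left dominated_e2_left_left dominated_slack) auto
  then show ?thesis
  proof (rule dominated_eq, intro mark_fun_eqI, goal_cases)
    case 1
    show ?case
      by (simp only: trio_simps scaled_def base_factor_def leaf_factor_def c cst_simps) algebra
  next
    case 2
    show ?case
      unfolding scaled_def base_factor_def leaf_factor_def trio_simps
      by (subst h'[of "Y * (1 + X) ^ 3", symmetric]) (simp only: mult_zero_right add_0_right add_0_left cst_simps, algebra)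
  next
    case 3
    show ?case
      unfolding scaled_def base_factor_def leaf_factor_def trio_simps
      by (subst h'[of "X * (1 + Y) ^ 3", symmetric]) (simp only: mult_zero_right add_0_right add_0_left cst_simps, algebra)
  qed
qed

lemma dominated_site:
  assumes "dominated (scaled \<nu> (\<lambda>s. base_factor s * leaf_factor s ^ k))" "k \<le> l"
  shows "dominated (scaled (\<nu> / 2 ^ j) (site l p q j))"
proof -
  have h: "cst (1 / 2) ^ j = cst (1 / 2 ^ j)" by (simp add: power_divide flip: cst_power)
  have d: "cst (\<nu> / 2 ^ j) = cst (1 / 2 ^ j) * cst \<nu>" by (simp flip: cst_mult)
  obtain i where i: "l = k + i" using assms(2) le_Suc_ex by blast
  have "dominated (\<lambda>s. cst (1 / 2 ^ j) * (scaled \<nu> (\<lambda>s. base_factor s * leaf_factor s ^ k) s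
      * (leaf_factor s ^ i * (free_factor s ^ p * half_factor s ^ q))))"
    by (rule dominated_scale[OF _ dominated_mult[OF assms(1) dominated_mult[OF
            dominated_power[OF dominated_leaf_factor] dominated_mult[OF
            dominated_power[OF dominated_free_factor] dominated_power[OF dominated_half_factor]]]]]) simp
  then show ?thesis
    by (rule dominated_eq) (rule mark_fun_eqI;
        simp add: scaled_def site_def link_factor_def i power_add h d mult_ac)
qed

lemma site_Neither_schur_pos: "site l p q j Neither \<in> schur_pos"
proof -
  have "leaf_factor Neither \<in> schur_pos" "free_factor Neither \<in> schur_pos" "half_factor Neither \<in> schur_pos"
    by (intro dominated_Neither_schur_pos dominated_leaf_factor dominated_free_factor dominated_half_factor)+
  then show ?thesis
    by (auto simp: site_def base_factor_def link_factor_def intro!: schur_pos_mult schur_pos_power schur_pos_one)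
qed

text \<open>At degree at most two the marked weights \<open>Y (1 + X)^l \<dots>\<close> and \<open>X (1 + Y)^l \<dots>\<close> are still so balanced that
their sum is Schur positive. There are ten cases, each with an explicit expansion.\<close>

lemma site_balanced:
  assumes "l \<le> 2" "p + q \<le> l"
  shows "site l p q j InY + site l p q j InX \<in> schur_pos"
proof -
  have c000: "Y * (1 + X) ^ 0 * ((1 + 3 * X) * (1 + Y)) ^ 0 * ((1 + 2 * X) * (1 + Y)) ^ 0
      + X * (1 + Y) ^ 0 * ((1 + X) * (1 + 3 * Y)) ^ 0 * ((1 + X) * (1 + 2 * Y)) ^ 0
      = cst 1 * e2 ^ 0 * hsym (Suc 0)"
    unfolding hsym_0 hsym_1 hsym_2 hsym_3 cst_simps power_0 power_one_right by algebra
  have c100: "Y * (1 + X) ^ 1 * ((1 + 3 * X) * (1 + Y)) ^ 0 * ((1 + 2 * X) * (1 + Y)) ^ 0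
      + X * (1 + Y) ^ 1 * ((1 + X) * (1 + 3 * Y)) ^ 0 * ((1 + X) * (1 + 2 * Y)) ^ 0
      = cst 1 * e2 ^ 0 * hsym (Suc 0) + cst 2 * e2 ^ 1 * hsym 0"
    unfolding hsym_0 hsym_1 hsym_2 hsym_3 cst_simps power_0 power_one_right by algebra
  have c101: "Y * (1 + X) ^ 1 * ((1 + 3 * X) * (1 + Y)) ^ 0 * ((1 + 2 * X) * (1 + Y)) ^ 1
      + X * (1 + Y) ^ 1 * ((1 + X) * (1 + 3 * Y)) ^ 0 * ((1 + X) * (1 + 2 * Y)) ^ 1
      = cst 1 * e2 ^ 0 * hsym (Suc 0) + cst 1 * e2 ^ 0 * hsym 2 + cst 5 * e2 ^ 1 * hsym 0 + cst 5 * e2 ^ 1 * hsym (Suc 0) + cst 4 * e2 ^ 2 * hsym 0"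
    unfolding hsym_0 hsym_1 hsym_2 hsym_3 cst_simps power_0 power_one_right by algebra
  have c110: "Y * (1 + X) ^ 1 * ((1 + 3 * X) * (1 + Y)) ^ 1 * ((1 + 2 * X) * (1 + Y)) ^ 0
      + X * (1 + Y) ^ 1 * ((1 + X) * (1 + 3 * Y)) ^ 1 * ((1 + X) * (1 + 2 * Y)) ^ 0
      = cst 1 * e2 ^ 0 * hsym (Suc 0) + cst 1 * e2 ^ 0 * hsym 2 + cst 7 * e2 ^ 1 * hsym 0 + cst 7 * e2 ^ 1 * hsym (Suc 0) + cst 6 * e2 ^ 2 * hsym 0"
    unfolding hsym_0 hsym_1 hsym_2 hsym_3 cst_simps power_0 power_one_right by algebra
  have c200: "Y * (1 + X) ^ 2 * ((1 + 3 * X) * (1 + Y)) ^ 0 * ((1 + 2 * X) * (1 + Y)) ^ 0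
      + X * (1 + Y) ^ 2 * ((1 + X) * (1 + 3 * Y)) ^ 0 * ((1 + X) * (1 + 2 * Y)) ^ 0
      = cst 1 * e2 ^ 0 * hsym (Suc 0) + cst 4 * e2 ^ 1 * hsym 0 + cst 1 * e2 ^ 1 * hsym (Suc 0)"
    unfolding hsym_0 hsym_1 hsym_2 hsym_3 cst_simps power_0 power_one_right by algebra
  have c201: "Y * (1 + X) ^ 2 * ((1 + 3 * X) * (1 + Y)) ^ 0 * ((1 + 2 * X) * (1 + Y)) ^ 1
      + X * (1 + Y) ^ 2 * ((1 + X) * (1 + 3 * Y)) ^ 0 * ((1 + X) * (1 + 2 * Y)) ^ 1
      = cst 1 * e2 ^ 0 * hsym (Suc 0) + cst 1 * e2 ^ 0 * hsym 2 + cst 7 * e2 ^ 1 * hsym 0 + cst 9 * e2 ^ 1 * hsym (Suc 0) + cst 2 * e2 ^ 1 * hsym 2 + cst 8 * e2 ^ 2 * hsym 0 + cst 2 * e2 ^ 2 * hsym (Suc 0)"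
    unfolding hsym_0 hsym_1 hsym_2 hsym_3 cst_simps power_0 power_one_right by algebra
  have c202: "Y * (1 + X) ^ 2 * ((1 + 3 * X) * (1 + Y)) ^ 0 * ((1 + 2 * X) * (1 + Y)) ^ 2
      + X * (1 + Y) ^ 2 * ((1 + X) * (1 + 3 * Y)) ^ 0 * ((1 + X) * (1 + 2 * Y)) ^ 2
      = cst 1 * e2 ^ 0 * hsym (Suc 0) + cst 2 * e2 ^ 0 * hsym 2 + cst 10 * e2 ^ 1 * hsym 0 + cst 1 * e2 ^ 0 * hsym 3 + cst 24 * e2 ^ 1 * hsym (Suc 0) + cst 18 * e2 ^ 1 * hsym 2 + cst 34 * e2 ^ 2 * hsym 0 + cst 4 * e2 ^ 1 * hsym 3 + cst 33 * e2 ^ 2 * hsym (Suc 0) + cst 8 * e2 ^ 2 * hsym 2 + cst 16 * e2 ^ 3 * hsym 0 + cst 4 * e2 ^ 3 * hsym (Suc 0)"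
    unfolding hsym_0 hsym_1 hsym_2 hsym_3 cst_simps power_0 power_one_right by algebra
  have c210: "Y * (1 + X) ^ 2 * ((1 + 3 * X) * (1 + Y)) ^ 1 * ((1 + 2 * X) * (1 + Y)) ^ 0
      + X * (1 + Y) ^ 2 * ((1 + X) * (1 + 3 * Y)) ^ 1 * ((1 + X) * (1 + 2 * Y)) ^ 0
      = cst 1 * e2 ^ 0 * hsym (Suc 0) + cst 1 * e2 ^ 0 * hsym 2 + cst 9 * e2 ^ 1 * hsym 0 + cst 12 * e2 ^ 1 * hsym (Suc 0) + cst 3 * e2 ^ 1 * hsym 2 + cst 11 * e2 ^ 2 * hsym 0 + cst 3 * e2 ^ 2 * hsym (Suc 0)"
    unfolding hsym_0 hsym_1 hsym_2 hsym_3 cst_simps power_0 power_one_right by algebra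
  have c211: "Y * (1 + X) ^ 2 * ((1 + 3 * X) * (1 + Y)) ^ 1 * ((1 + 2 * X) * (1 + Y)) ^ 1
      + X * (1 + Y) ^ 2 * ((1 + X) * (1 + 3 * Y)) ^ 1 * ((1 + X) * (1 + 2 * Y)) ^ 1
      = cst 1 * e2 ^ 0 * hsym (Suc 0) + cst 2 * e2 ^ 0 * hsym 2 + cst 12 * e2 ^ 1 * hsym 0 + cst 1 * e2 ^ 0 * hsym 3 + cst 30 * e2 ^ 1 * hsym (Suc 0) + cst 24 * e2 ^ 1 * hsym 2 + cst 44 * e2 ^ 2 * hsym 0 + cst 6 * e2 ^ 1 * hsym 3 + cst 45 * e2 ^ 2 * hsym (Suc 0) + cst 12 * e2 ^ 2 * hsym 2 + cst 22 * e2 ^ 3 * hsym 0 + cst 6 * e2 ^ 3 * hsym (Suc 0)"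
    unfolding hsym_0 hsym_1 hsym_2 hsym_3 cst_simps power_0 power_one_right by algebra
  have c220: "Y * (1 + X) ^ 2 * ((1 + 3 * X) * (1 + Y)) ^ 2 * ((1 + 2 * X) * (1 + Y)) ^ 0
      + X * (1 + Y) ^ 2 * ((1 + X) * (1 + 3 * Y)) ^ 2 * ((1 + X) * (1 + 2 * Y)) ^ 0
      = cst 1 * e2 ^ 0 * hsym (Suc 0) + cst 2 * e2 ^ 0 * hsym 2 + cst 14 * e2 ^ 1 * hsym 0 + cst 1 * e2 ^ 0 * hsym 3 + cst 37 * e2 ^ 1 * hsym (Suc 0) + cst 32 * e2 ^ 1 * hsym 2 + cst 56 * e2 ^ 2 * hsym 0 + cst 9 * e2 ^ 1 * hsym 3 + cst 61 * e2 ^ 2 * hsym (Suc 0) + cst 18 * e2 ^ 2 * hsym 2 + cst 30 * e2 ^ 3 * hsym 0 + cst 9 * e2 ^ 3 * hsym (Suc 0)"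
    unfolding hsym_0 hsym_1 hsym_2 hsym_3 cst_simps power_0 power_one_right by algebra
  have "Y * (1 + X) ^ l * ((1 + 3 * X) * (1 + Y)) ^ p * ((1 + 2 * X) * (1 + Y)) ^ q
      + X * (1 + Y) ^ l * ((1 + X) * (1 + 3 * Y)) ^ p * ((1 + X) * (1 + 2 * Y)) ^ q \<in> schur_pos" (is "?F \<in> schur_pos")
  proof -
    have "(l, p, q) \<in> {(0,0,0), (1,0,0), (1,0,1), (1,1,0), (2,0,0), (2,0,1), (2,0,2), (2,1,0), (2,1,1), (2,2,0)}"
      using assms by (cases l; cases p; cases q; force)
    then show ?thesis
      by (elim insertE emptyE Pair_inject; simp only: c000 c100 c101 c110 c200 c201 c202 c210 c211 c220;
          intro schur_pos_add schur_pos_basis; simp)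
  qed
  then have "cst ((1 / 2) ^ j) * ?F \<in> schur_pos" by (intro schur_pos_mult schur_pos_cst) auto
  then show ?thesis
    by (simp add: site_def base_factor_def leaf_factor_def free_factor_def half_factor_def link_factor_def
        cst_power distrib_left mult_ac)
qed

text \<open>Degree one and two rely on \<open>site_balanced\<close>, with \<open>\<nu> (1 - (3/4)^j)\<close> at most \<open>1/4\<close> and
\<open>7/32\<close>, respectively. From degree three on, \<open>\<nu> = 3/8\<close> and \<open>\<rho> = 5/8\<close> satisfy \<open>\<nu> \<le> 1 - \<rho>\<close>.\<close>

lemma site_tame:
  assumes "p + q + j \<le> l"
  shows "\<exists>\<nu> \<rho>. tame \<nu> \<rho> j (site l p q j)"
proof -
  consider "l = 0" | "l = 1" | "l = 2" | "3 \<le> l" by linarith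
  then show ?thesis
  proof cases
    case 1
    then have "tame 0 (2 / 3) j (site l p q j)"
      using assms site_balanced[of l p q j] site_Neither_schur_pos by (simp add: tame_def)
    then show ?thesis by blast
  next
    case 2
    then have "j = 0 \<or> j = 1" using assms by auto
    moreover have "dominated (scaled (1 / 2 ^ j) (site l p q j))"
      using dominated_site[of 1 1 l j p q] dominated_base_1 2 by simp
    ultimately have "tame 1 (2 / 3) j (site l p q j)"
      using assms 2 site_balanced[of l p q j] site_Neither_schur_pos by (auto simp: tame_def)
    then show ?thesis by blast
  next
    case 3
    then have "j = 0 \<or> j = 1 \<or> j = 2" using assms by auto
    moreover have "dominated (scaled ((1 / 2) / 2 ^ j) (site l p q j))"
      using dominated_site[OF dominated_base_2, of l j p q] 3 by simp
    ultimately have "tame (1 / 2) (2 / 3) j (site l p q j)"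
      using assms 3 site_balanced[of l p q j] site_Neither_schur_pos
      unfolding tame_def by (auto simp: power2_eq_square)
    then show ?thesis by blast
  next
    case 4
    have "dominated (scaled ((3 / 8) / 2 ^ j) (site l p q j))"
      using dominated_site[OF dominated_base_3, of l j p q] 4 by simp
    then have "tame (3 / 8) (5 / 8) j (site l p q j)"
      using site_Neither_schur_pos unfolding tame_def by auto
    then show ?thesis by blast
  qed
qed

section \<open>Expanding the edges\<close>

text \<open>The contribution of an edge with \<open>k\<close> chosen ends, up to a factor \<open>1 + z\<close>. The leaves of the unchosen
ends are free. The other four new vertices, a path, count like one free vertex (the omitted factor)
and three mutually exclusive ones, of which each chosen end blocks one.\<close>

definition edge_factor :: "'r::comm_ring_1 \<Rightarrow> nat \<Rightarrow> 'r" where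
  "edge_factor z k = (1 + z) ^ (2 - k) * (1 + of_nat (3 - k) * z)"

definition pair_factor :: "'v set \<Rightarrow> 'v set \<Rightarrow> 'v set \<Rightarrow> ('v \<Rightarrow> mark) \<Rightarrow> bpoly" where
  "pair_factor B U e g = edge_factor X (card (e \<inter> (B \<union> {v \<in> U. g v = InX})))
     * edge_factor Y (card (e \<inter> (B \<union> {v \<in> U. g v = InY})))"

lemma card_pair_Int:
  assumes "u \<noteq> w"
  shows "card ({u, w} \<inter> S) = (if u \<in> S then 1 else 0) + (if w \<in> S then 1 else 0)"
  using assms by (auto simp: Int_insert_left)

lemma cst_half: "2 * cst (1 / 2) = 1" "cst (1 / 2) * (2 * F) = F"
proof -
  show a: "2 * cst (1 / 2) = 1" using cst_mult[of 2 "1 / 2"] by simp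
  have "cst (1 / 2) * (2 * F) = (2 * cst (1 / 2)) * F" by (simp only: mult_ac)
  then show "cst (1 / 2) * (2 * F) = F" unfolding a by simp
qed

text \<open>The splitting of an edge into two uncoupled parts and a coupled one. With any coefficient in place
of \<open>6\<close> and a corresponding change of the uncoupled part at unmarked ends, a marked end would halve the
coupled part. The coefficient \<open>6\<close> is the largest for which the uncoupled part is still dominated, and
it makes two marked ends as unlikely as possible.\<close>

lemma pair_factor_inside:
  assumes "u \<noteq> w" "u \<in> U" "w \<in> U" "U \<inter> B = {}"
  shows "pair_factor B U {u, w} g = leaf_factor (g u) * leaf_factor (g w) *
    (cst (1 / 2) * free_factor (g u) + cst (1 / 2) * free_factor (g w)
     + 6 * e2 * (link_factor (g u) * link_factor (g w) * cst (pair_weight (g u) (g w))))"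
proof -
  define h where "h = cst (1 / 2)"
  have h: "2 * h = 1" using cst_half(1) by (simp add: h_def)
  have c: "cst (2 / 3) * 3 = 2" using cst_mult[of "2 / 3" 3] by simp
  have "u \<notin> B" "w \<notin> B" using assms by auto
  with assms have "pair_factor B U {u, w} g
    = edge_factor X ((if g u = InX then 1 else 0) + (if g w = InX then 1 else 0))
     * edge_factor Y ((if g u = InY then 1 else 0) + (if g w = InY then 1 else 0))"
    by (simp add: pair_factor_def card_pair_Int)
  moreover have "edge_factor X ((if s = InX then 1 else 0) + (if t = InX then 1 else 0))
     * edge_factor Y ((if s = InY then 1 else 0) + (if t = InY then 1 else 0))
     = leaf_factor s * leaf_factor t * (h * free_factor s + h * free_factor t
        + 6 * e2 * (link_factor s * link_factor t * cst (pair_weight s t)))" for s t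
  proof -
    have 0: "edge_factor z 0 = (1 + z) ^ 2 * (1 + 3 * z)" "edge_factor z (Suc 0) = (1 + z) * (1 + 2 * z)"
      "edge_factor z (Suc (Suc 0)) = 1 + z" for z :: bpoly
      by (simp_all add: edge_factor_def numeral_2_eq_2)
    have 1: "h * (2 * F) = F" for F using cst_half(2) by (simp add: h_def)
    have h6: "6 * h = 3"
      using 1[of 3] by (simp add: mult.commute)
    have h6': "6 * (h * h * cst (2 / 3)) = 1"
    proof -
      have "6 * (h * h * cst (2 / 3)) = (cst (2 / 3) * 6) * (h * h)"
        by (simp only: mult_ac)
      also have "cst (2 / 3) * 6 = 4"
        using cst_mult[of "2 / 3" 6] by simp
      also have "4 * (h * h) = h * (2 * (h * (2 * 1)))"
        by (simp add: mult_ac)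
      finally show ?thesis unfolding 1 .
    qed
    define k :: bpoly where "k = trio (trio 6 3 3 s) (trio 3 0 1 s) (trio 3 1 0 s) t"
    have k: "6 * (link_factor s * link_factor t * cst (pair_weight s t)) = k"
      unfolding link_factor_def h_def[symmetric] pair_weight_def k_def
      by (cases s; cases t; simp add: h6 h6')
    define m where "m = trio
      (trio (1 + 3 * X + 3 * Y + 3 * e2) (1 + 3 * X + 2 * Y + 3 * e2) (1 + 2 * X + 3 * Y + 3 * e2) s)
      (trio (1 + 3 * X + 2 * Y + 3 * e2) (1 + 3 * X + Y + 3 * e2) (1 + 2 * X + 2 * Y + 3 * e2) s)
      (trio (1 + 2 * X + 3 * Y + 3 * e2) (1 + 2 * X + 2 * Y + 3 * e2) (1 + X + 3 * Y + 3 * e2) s) t"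
    have "h * free_factor s + h * free_factor t = h * (2 * m)"
      unfolding free_factor_def m_def by (cases s; cases t; simp add: algebra_simps)
    then have m: "h * free_factor s + h * free_factor t = m" unfolding 1 .
    have "edge_factor X ((if s = InX then 1 else 0) + (if t = InX then 1 else 0))
      * edge_factor Y ((if s = InY then 1 else 0) + (if t = InY then 1 else 0))
      = leaf_factor s * leaf_factor t * (m + e2 * k)"
      unfolding leaf_factor_def m_def k_def
      by (cases s; cases t; simp add: 0 power2_eq_square; simp add: algebra_simps)
    then show ?thesis
      unfolding m k[symmetric] by (simp only: mult_ac)
  qed
  ultimately show ?thesis unfolding h_def[symmetric] by simp
qed

lemma pair_factor_crossing:
  assumes "u \<in> U" "w \<in> B" "U \<inter> B = {}"
  shows "pair_factor B U {u, w} g = leaf_factor (g u) * half_factor (g u)"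
proof -
  have "u \<noteq> w" "u \<notin> B" "w \<notin> U" using assms by auto
  with assms show ?thesis
    by (cases "g u") (simp_all add: pair_factor_def card_pair_Int edge_factor_def leaf_factor_def half_factor_def
      numeral_2_eq_2 mult_ac)
qed

lemma pair_factor_outside:
  assumes "u \<noteq> w" "u \<in> B" "w \<in> B"
  shows "pair_factor B U {u, w} g = (1 + X) * (1 + Y)"
  using assms by (simp add: pair_factor_def card_pair_Int edge_factor_def numeral_2_eq_2)

text \<open>An intermediate stage of the expansion: the edges in \<open>J\<close> have become links, those in \<open>E\<close> are not yet
expanded, and the exponents \<open>l\<close>, \<open>p\<close>, \<open>q\<close> count the leaf, free and half factors collected at each vertex.\<close>

definition mark_sum :: "'v set \<Rightarrow> 'v set \<Rightarrow> 'v set set \<Rightarrow> 'v set set \<Rightarrow> ('v \<Rightarrow> nat) \<Rightarrow> ('v \<Rightarrow> nat) \<Rightarrow> ('v \<Rightarrow> nat) \<Rightarrow> bpoly" where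
  "mark_sum B U E J l p q = (\<Sum>g\<in>U \<rightarrow>\<^sub>E UNIV.
     (\<Prod>v\<in>U. site (l v) (p v) (q v) (card (link J v)) (g v))
     * ((\<Prod>e\<in>E. pair_factor B U e g) * cst (\<Prod>e\<in>J. link_weight g e)))"

lemma prod_power_indicator:
  fixes F :: "'v \<Rightarrow> 'r::comm_monoid_mult"
  shows "finite U \<Longrightarrow> (\<Prod>v\<in>U. F v ^ (if v \<in> N then 1 else 0)) = (\<Prod>v\<in>N \<inter> U. F v)"
  by (induction U rule: finite_induct) (auto simp: Int_insert_right)

lemma prod_site_bump:
  assumes "finite U"
  shows "(\<Prod>v\<in>U. site (bump l L v) (bump p P v) (bump q H v) (bump j K v) (g v))
     = (\<Prod>v\<in>U. site (l v) (p v) (q v) (j v) (g v))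
      * ((\<Prod>v\<in>L \<inter> U. leaf_factor (g v)) * (\<Prod>v\<in>P \<inter> U. free_factor (g v))
       * (\<Prod>v\<in>H \<inter> U. half_factor (g v)) * (\<Prod>v\<in>K \<inter> U. link_factor (g v)))"
  unfolding site_def bump_def power_add prod.distrib prod_power_indicator[OF assms, of _ L]
    prod_power_indicator[OF assms, of _ P] prod_power_indicator[OF assms, of _ H] prod_power_indicator[OF assms, of _ K]
  by (simp only: mult_ac)

lemma bump_empty [simp]: "bump a {} = a"
  by (rule ext) (simp add: bump_def)

lemma finite_link:
  assumes "finite J" "\<forall>e\<in>J. card e = 2"
  shows "finite (link J v)"
proof (rule finite_subset)
  show "link J v \<subseteq> \<Union>J" by (auto simp: link_def)
  show "finite (\<Union>J)" using assms by (intro finite_Union) (auto intro: card_ge_0_finite)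
qed

lemma card_link_insert:
  assumes "finite J" "\<forall>e\<in>J. card e = 2" "u \<noteq> w" "{u, w} \<notin> J"
  shows "(\<lambda>v. card (link (insert {u, w} J) v)) = bump (\<lambda>v. card (link J v)) {u, w}"
proof
  fix v
  have new: "u \<notin> link J w" "w \<notin> link J u" using assms(4) by (auto simp: link_def insert_commute)
  have "link (insert {u, w} J) v = (if v = u then insert w (link J v) else if v = w then insert u (link J v) else link J v)"
    using assms(3) by (auto simp: link_def doubleton_eq_iff)
  then show "card (link (insert {u, w} J) v) = bump (\<lambda>v. card (link J v)) {u, w} v"
    using new finite_link[OF assms(1,2), of v] by (auto simp: bump_def)
qed

lemma mark_sum_no_edges:
  assumes "finite U" "finite J" "\<forall>e\<in>J. card e = 2 \<and> e \<subseteq> U" "\<forall>v\<in>U. p v + q v + card (link J v) \<le> l v"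
  shows "mark_sum B U {} J l p q \<in> schur_pos"
proof -
  have J: "\<forall>e\<in>J. card e = 2" using assms(3) by blast
  define \<Phi> where "\<Phi> = (\<lambda>v. site (l v) (p v) (q v) (card (link J v)))"
  have "\<forall>v\<in>U. \<exists>\<nu> \<rho>. tame \<nu> \<rho> (card (link J v)) (\<Phi> v)"
    using assms(4) site_tame unfolding \<Phi>_def by blast
  then obtain \<nu> \<rho> where tm: "\<forall>v\<in>U. tame (\<nu> v) (\<rho> v) (card (link J v)) (\<Phi> v)" by metis
  interpret linked_system \<Phi> J \<nu> \<rho> "\<lambda>v. card (link J v)"
    using J by unfold_locales
  have "admissible U"
    unfolding admissible_def using assms(1) tm finite_link[OF assms(2) J] by (auto intro: card_mono)
  then have "linked_sum \<Phi> J U (\<lambda>_. 0) (\<lambda>_. 0) \<in> schur_pos" by (rule linked_sum_schur_pos)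
  moreover have "touch 0 0 s = 1" for s by (cases s) (auto simp: touch_def)
  moreover have "{e \<in> J. e \<subseteq> U} = J" using assms(3) by auto
  ultimately show ?thesis by (simp add: mark_sum_def linked_sum_def weight_def \<Phi>_def)
qed

text \<open>Each edge contributes a leaf factor at its ends and at most one further factor at each of them, so
\<open>p + q + |links| \<le> l\<close> is preserved. This is where the degree restrictions of \<open>site_tame\<close> come from.\<close>

lemma mark_sum_schur_pos:
  assumes "finite E" "finite U" "finite J" "U \<inter> B = {}"
    and "\<forall>e\<in>E. card e = 2 \<and> e \<subseteq> U \<union> B" "\<forall>e\<in>J. card e = 2 \<and> e \<subseteq> U" "E \<inter> J = {}"
    and "\<forall>v\<in>U. p v + q v + card (link J v) \<le> l v"
  shows "mark_sum B U E J l p q \<in> schur_pos"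
  using assms
proof (induction E arbitrary: J l p q rule: finite_induct)
  case empty
  then show ?case by (intro mark_sum_no_edges) auto
next
  case (insert e E)
  note fin = \<open>finite U\<close> \<open>finite J\<close> and disj = \<open>U \<inter> B = {}\<close>
  have J: "\<forall>e\<in>J. card e = 2" and eJ: "e \<notin> J" using insert.prems by auto
  have sum_insert: "mark_sum B U (insert e E) J l p q = (\<Sum>g\<in>U \<rightarrow>\<^sub>E UNIV.
     pair_factor B U e g * ((\<Prod>v\<in>U. site (l v) (p v) (q v) (card (link J v)) (g v))
     * ((\<Prod>e\<in>E. pair_factor B U e g) * cst (\<Prod>e\<in>J. link_weight g e))))"
    unfolding mark_sum_def using insert.hyps by (simp add: mult_ac)
  have step: "mark_sum B U E J' l' p' q' \<in> schur_pos"
    if "finite J'" "\<forall>e\<in>J'. card e = 2 \<and> e \<subseteq> U" "E \<inter> J' = {}" "\<forall>v\<in>U. p' v + q' v + card (link J' v) \<le> l' v"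
    for J' l' p' q'
    using insert.IH insert.prems that by blast
  have EJ: "E \<inter> J = {}" using insert.prems by auto
  obtain x y where xy: "e = {x, y}" "x \<noteq> y" "x \<in> U \<union> B" "y \<in> U \<union> B"
    using insert.prems(4) by (auto simp: card_2_iff)
  consider "x \<in> B" "y \<in> B" | u w where "e = {u, w}" "u \<in> U" "w \<in> B" | "x \<in> U" "y \<in> U"
    using xy by (auto simp: insert_commute)
  then show ?case
  proof cases
    case 1
    then have "mark_sum B U (insert e E) J l p q = (1 + X) * (1 + Y) * mark_sum B U E J l p q"
      unfolding sum_insert unfolding xy(1) pair_factor_outside[OF xy(2) 1] mark_sum_def by (simp add: sum_distrib_left)
    moreover have "(1 + X) * (1 + Y) = 1 + (e1 + e2)" by (simp add: algebra_simps)
    moreover have "1 + (e1 + e2) \<in> schur_pos" by (intro schur_pos_add[OF schur_pos_one schur_pos_add[OF schur_pos_e1 schur_pos_e2]])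
    moreover have "mark_sum B U E J l p q \<in> schur_pos" using insert.prems EJ by (intro step) auto
    ultimately show ?thesis using schur_pos_mult by metis
  next
    case (2 u w)
    have "mark_sum B U (insert e E) J l p q = mark_sum B U E J (bump l {u}) p (bump q {u})"
      unfolding sum_insert
      unfolding 2(1) pair_factor_crossing[OF 2(2,3) disj] mark_sum_def
        prod_site_bump[OF fin(1), of l "{u}" p "{}" q "{u}" "\<lambda>v. card (link J v)" "{}", unfolded bump_empty]
      using 2(2) by (simp add: mult_ac)
    moreover have "mark_sum B U E J (bump l {u}) p (bump q {u}) \<in> schur_pos"
      using insert.prems EJ by (intro step) (auto simp: bump_def)
    ultimately show ?thesis by simp
  next
    case 3
    have Int: "{x, y} \<inter> U = {x, y}" "{x} \<inter> U = {x}" "{y} \<inter> U = {y}" "{} \<inter> U = {}" using 3 by auto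
    define J' where "J' = insert {x, y} J"
    have eJ': "{x, y} \<notin> J" using eJ xy by simp
    note link' = card_link_insert[OF fin(2) J xy(2) eJ', folded J'_def]
    define A where "A = mark_sum B U E J (bump l {x, y}) (bump p {x}) q"
    define A' where "A' = mark_sum B U E J (bump l {x, y}) (bump p {y}) q"
    define A'' where "A'' = mark_sum B U E J' (bump l {x, y}) p q"
    have "mark_sum B U (insert e E) J l p q = cst (1 / 2) * A + cst (1 / 2) * A' + 6 * e2 * A''"
    proof -
      have S1: "(\<Prod>v\<in>U. site (bump l {x, y} v) (bump p {z} v) (q v) (card (link J v)) (g v))
         = (\<Prod>v\<in>U. site (l v) (p v) (q v) (card (link J v)) (g v)) * (leaf_factor (g x) * leaf_factor (g y) * free_factor (g z))"
        if "z \<in> U" for z g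
        using prod_site_bump[OF fin(1), of l "{x, y}" p "{z}" q "{}" "\<lambda>v. card (link J v)" "{}", unfolded bump_empty]
          3 xy(2) that by simp
      have S2: "(\<Prod>v\<in>U. site (bump l {x, y} v) (p v) (q v) (card (link J' v)) (g v))
         = (\<Prod>v\<in>U. site (l v) (p v) (q v) (card (link J v)) (g v)) *
           (leaf_factor (g x) * leaf_factor (g y) * (link_factor (g x) * link_factor (g y)))" for g
        using prod_site_bump[OF fin(1), of l "{x, y}" p "{}" q "{}" "\<lambda>v. card (link J v)" "{x, y}", unfolded bump_empty]
          3 xy(2) fun_cong[OF link'] by simp
      have S3: "(\<Prod>e\<in>J'. link_weight g e) = pair_weight (g x) (g y) * (\<Prod>e\<in>J. link_weight g e)" for g
        unfolding J'_def using fin(2) eJ' by (simp add: link_weight_pair)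
      show ?thesis
        unfolding sum_insert
        unfolding A_def A'_def A''_def mark_sum_def S1[OF 3(1)] S1[OF 3(2)] S2 S3 sum_distrib_left
          sum.distrib[symmetric]
        unfolding xy(1) pair_factor_inside[OF xy(2) 3 disj] cst_mult
        by (intro sum.cong refl) (simp only: distrib_left distrib_right mult_ac)
    qed
    moreover have "A \<in> schur_pos" "A' \<in> schur_pos"
      unfolding A_def A'_def using insert.prems EJ xy(2) by (intro step; auto simp: bump_def)+
    moreover have "A'' \<in> schur_pos"
      unfolding A''_def
    proof (rule step)
      show "finite J'" using fin by (simp add: J'_def)
      show "\<forall>e\<in>J'. card e = 2 \<and> e \<subseteq> U" using insert.prems(5) 3 xy(2) by (auto simp: J'_def)
      show "E \<inter> J' = {}" using EJ insert.hyps(2) xy(1) by (auto simp: J'_def)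
      show "\<forall>v\<in>U. p v + q v + card (link J' v) \<le> bump l {x, y} v"
        using insert.prems(7) fun_cong[OF link'] by (auto simp: bump_def)
    qed
    ultimately show ?thesis
      by (auto intro!: schur_pos_add schur_pos_mult[OF schur_pos_cst] schur_pos_mult[OF schur_pos_mult[OF schur_pos_numeral schur_pos_e2]])
  qed
qed

section \<open>Pairs of vertex sets\<close>

definition subset_sum :: "'v set \<Rightarrow> 'v set set \<Rightarrow> 'r::comm_ring_1 \<Rightarrow> 'r" where
  "subset_sum V E z = (\<Sum>S\<in>Pow V. z ^ card S * (\<Prod>e\<in>E. edge_factor z (card (e \<inter> S))))"

lemma sum_pairs_by_intersection:
  fixes f :: "'v set \<Rightarrow> 'v set \<Rightarrow> 'r::comm_monoid_add"
  assumes "finite V"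
  shows "(\<Sum>S\<in>Pow V. \<Sum>S'\<in>Pow V. f S S') = (\<Sum>B\<in>Pow V. \<Sum>g\<in>(V - B) \<rightarrow>\<^sub>E UNIV.
     f (B \<union> {v \<in> V - B. g v = InX}) (B \<union> {v \<in> V - B. g v = InY}))"
proof -
  \<comment> \<open>the default value of \<open>restrict\<close> makes the marking unique\<close>
  define enc where "enc = (\<lambda>(S, S'). (S \<inter> S', restrict (\<lambda>v. if v \<in> S then InX else if v \<in> S' then InY else Neither) (V - S \<inter> S')))"
  define dec where "dec = (\<lambda>(B, g). (B \<union> {v \<in> V - B. g v = InX}, B \<union> {v \<in> V - B. g v = InY}))"
  have "(\<Sum>(S, S')\<in>Pow V \<times> Pow V. f S S') = (\<Sum>(B, g)\<in>(SIGMA B:Pow V. (V - B) \<rightarrow>\<^sub>E UNIV).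
     f (B \<union> {v \<in> V - B. g v = InX}) (B \<union> {v \<in> V - B. g v = InY}))"
  proof (rule sum.reindex_bij_witness[of _ dec enc])
    fix a assume "a \<in> Pow V \<times> Pow V"
    then obtain S S' where a: "a = (S, S')" "S \<subseteq> V" "S' \<subseteq> V" by auto
    show dec: "dec (enc a) = a"
      using a by (auto simp: enc_def dec_def split: if_splits)
    show "enc a \<in> (SIGMA B:Pow V. (V - B) \<rightarrow>\<^sub>E UNIV)"
      using a by (auto simp: enc_def)
    have "(case enc a of (B, g) \<Rightarrow> f (B \<union> {v \<in> V - B. g v = InX}) (B \<union> {v \<in> V - B. g v = InY}))
       = (case dec (enc a) of (S, S') \<Rightarrow> f S S')"
      by (simp add: dec_def split: prod.splits)
    then show "(case enc a of (B, g) \<Rightarrow> f (B \<union> {v \<in> V - B. g v = InX}) (B \<union> {v \<in> V - B. g v = InY}))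
       = (case a of (S, S') \<Rightarrow> f S S')"
      unfolding dec .
  next
    fix b assume "b \<in> (SIGMA B:Pow V. (V - B) \<rightarrow>\<^sub>E (UNIV :: mark set))"
    then obtain B g where b: "b = (B, g)" "B \<subseteq> V" "g \<in> (V - B) \<rightarrow>\<^sub>E UNIV" by auto
    have B: "fst (dec b) \<inter> snd (dec b) = B" using b by (auto simp: dec_def)
    have "restrict (\<lambda>v. if v \<in> fst (dec b) then InX else if v \<in> snd (dec b) then InY else Neither) (V - B) = g"
    proof
      fix v
      show "restrict (\<lambda>v. if v \<in> fst (dec b) then InX else if v \<in> snd (dec b) then InY else Neither) (V - B) v = g v"
      proof (cases "v \<in> V - B")
        case True
        then show ?thesis using b by (cases "g v") (auto simp: dec_def)
      next
        case False
        then show ?thesis using b(3) by (auto simp: PiE_def extensional_def restrict_def)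
      qed
    qed
    then show "enc (dec b) = b"
      using B unfolding b(1) by (simp add: enc_def case_prod_unfold)
    show "dec b \<in> Pow V \<times> Pow V"
      using b by (auto simp: dec_def)
  qed
  then show ?thesis
    using assms by (simp add: sum.cartesian_product sum.Sigma finite_PiE)
qed

lemma power_card_eq_prod_base:
  assumes "finite U" "finite B" "U \<inter> B = {}"
  shows "X ^ card (B \<union> {v \<in> U. g v = InX}) * Y ^ card (B \<union> {v \<in> U. g v = InY})
     = e2 ^ card B * (\<Prod>v\<in>U. base_factor (g v))"
proof -
  have "card (B \<union> {v \<in> U. g v = s}) = card B + card {v \<in> U. g v = s}" for s
    using assms by (intro card_Un_disjoint) auto
  moreover have "(\<Prod>v\<in>U. base_factor (g v)) = X ^ card {v \<in> U. g v = InX} * Y ^ card {v \<in> U. g v = InY}"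
  proof -
    have "base_factor s = (if s = InX then X else 1) * (if s = InY then Y else 1)" for s
      by (cases s) (simp_all add: base_factor_def)
    then show ?thesis
      using assms(1) by (simp add: prod.distrib flip: prod.inter_filter)
  qed
  ultimately show ?thesis
    by (simp add: power_add power_mult_distrib mult_ac)
qed

theorem subset_sum_schur_pos:
  assumes "finite V" "\<forall>e\<in>E. card e = 2 \<and> e \<subseteq> V"
  shows "subset_sum V E X * subset_sum V E Y \<in> schur_pos"
proof -
  have finE: "finite E" by (rule finite_subset[of _ "Pow V"]) (use assms in auto)
  define f where "f = (\<lambda>S S'. X ^ card S * Y ^ card S' *
    (\<Prod>e\<in>E. edge_factor X (card (e \<inter> S)) * edge_factor Y (card (e \<inter> S'))))"
  have "subset_sum V E X * subset_sum V E Y = (\<Sum>S\<in>Pow V. \<Sum>S'\<in>Pow V. f S S')"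
    unfolding subset_sum_def sum_product f_def prod.distrib by (simp only: mult_ac)
  also have "\<dots> = (\<Sum>B\<in>Pow V. e2 ^ card B * mark_sum B (V - B) E {} (\<lambda>_. 0) (\<lambda>_. 0) (\<lambda>_. 0))"
    unfolding sum_pairs_by_intersection[OF assms(1)]
  proof (intro sum.cong refl)
    fix B assume "B \<in> Pow V"
    then have "finite (V - B)" "finite B" "(V - B) \<inter> B = {}" using assms(1) finite_subset by auto
    note eq = power_card_eq_prod_base[OF this]
    have "f (B \<union> {v \<in> V - B. g v = InX}) (B \<union> {v \<in> V - B. g v = InY})
      = e2 ^ card B * ((\<Prod>v\<in>V - B. base_factor (g v)) * (\<Prod>e\<in>E. pair_factor B (V - B) e g))" for g
      unfolding f_def pair_factor_def eq by (simp only: mult_ac)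
    then show "(\<Sum>g\<in>(V - B) \<rightarrow>\<^sub>E UNIV. f (B \<union> {v \<in> V - B. g v = InX}) (B \<union> {v \<in> V - B. g v = InY}))
      = e2 ^ card B * mark_sum B (V - B) E {} (\<lambda>_. 0) (\<lambda>_. 0) (\<lambda>_. 0)"
      by (simp add: mark_sum_def site_def link_def sum_distrib_left)
  qed
  also have "\<dots> \<in> schur_pos"
  proof (intro schur_pos_sum schur_pos_mult[OF schur_pos_power[OF schur_pos_e2]])
    fix B assume "B \<in> Pow V"
    then show "mark_sum B (V - B) E {} (\<lambda>_. 0) (\<lambda>_. 0) (\<lambda>_. 0) \<in> schur_pos"
      using assms finE by (intro mark_sum_schur_pos) (auto simp: link_def)
  qed
  finally show ?thesis .
qed

text \<open>The coefficient of \<open>X^i Y^j\<close> in the product is \<open>a i * a j\<close>; compare the middle of an antidiagonal with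
its neighbour.\<close>

lemma log_concave_if_schur_pos:
  fixes a :: "nat \<Rightarrow> nat"
  assumes "(\<Sum>k\<le>n. of_nat (a k) * X ^ k) * (\<Sum>k\<le>n. of_nat (a k) * Y ^ k) \<in> schur_pos"
    and "1 \<le> k" "k < n"
  shows "a (k - 1) * a (k + 1) \<le> (a k)\<^sup>2"
proof -
  define F where "F = (\<Sum>k\<le>n. of_nat (a k) * X ^ k) * (\<Sum>k\<le>n. of_nat (a k) * Y ^ k)"
  have cst_nat: "of_nat m = cst (of_nat m)" for m
    by (induction m) (simp_all add: cst_add)
  have F: "F = (\<Sum>i\<le>n. \<Sum>j\<le>n. cst (a i * a j) * (X ^ i * Y ^ j))"
    unfolding F_def sum_product cst_nat by (simp add: cst_mult mult_ac)
  have co: "bcoeff F i j = real (a i * a j)" if "i \<le> n" "j \<le> n" for i j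
  proof -
    have "bcoeff F i j = (\<Sum>i'\<le>n. \<Sum>j'\<le>n. if i = i' \<and> j = j' then real (a i' * a j') else 0)"
      unfolding F bcoeff_sum bcoeff_monomial by simp
    also have "\<dots> = (\<Sum>i'\<le>n. if i = i' then real (a i' * a j) else 0)"
    proof (intro sum.cong refl)
      fix i'
      have "(\<Sum>j'\<le>n. if i = i' \<and> j = j' then real (a i' * a j') else 0)
         = (\<Sum>j'\<le>n. if j = j' then (if i = i' then real (a i' * a j') else 0) else 0)"
        by (intro sum.cong) auto
      then show "(\<Sum>j'\<le>n. if i = i' \<and> j = j' then real (a i' * a j') else 0) = (if i = i' then real (a i' * a j) else 0)"
        using that(2) by (simp add: sum.delta)
    qed
    finally show ?thesis using that(1) by (simp add: sum.delta)
  qed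
  have "bcoeff F (k - 1) (k + 1) \<le> bcoeff F k k"
    using assms unfolding F_def by (intro schur_pos_bcoeff_mono) auto
  then have "real (a (k - 1) * a (k + 1)) \<le> real (a k * a k)"
    using co[of "k - 1" "k + 1"] co[of k k] assms(2,3) by simp
  then show ?thesis unfolding power2_eq_square by (simp only: of_nat_le_iff)
qed

section \<open>Independent sets of the edge replacement\<close>

definition inner_vertices :: "w4_vertex set" where
  "inner_vertices = {P2, P3, Q1, Q2, Q3, Q4}"

text \<open>Independence inside one copy of \<open>W4\<close>, where \<open>a\<close> and \<open>b\<close> tell whether the two ends are chosen.\<close>

definition gadget_ok :: "bool \<Rightarrow> bool \<Rightarrow> w4_vertex set \<Rightarrow> bool" where
  "gadget_ok a b T \<longleftrightarrow> \<not> (a \<and> P2 \<in> T) \<and> \<not> (P2 \<in> T \<and> P3 \<in> T) \<and> \<not> (b \<and> P3 \<in> T)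
     \<and> \<not> (a \<and> Q1 \<in> T) \<and> \<not> (P2 \<in> T \<and> Q2 \<in> T) \<and> \<not> (P3 \<in> T \<and> Q3 \<in> T) \<and> \<not> (b \<and> Q4 \<in> T)"

lemma sum_Pow_insert:
  assumes "a \<notin> A" "finite A"
  shows "(\<Sum>T\<in>Pow (insert a A). f T) = (\<Sum>T\<in>Pow A. f T) + (\<Sum>T\<in>Pow A. f (insert a T) :: 'r::comm_monoid_add)"
proof -
  have "Pow A \<inter> insert a ` Pow A = {}" using assms by auto
  moreover have "inj_on (insert a) (Pow A)" using assms by (auto simp: inj_on_def)
  ultimately show ?thesis
    using assms by (simp add: Pow_insert sum.union_disjoint sum.reindex)
qed

lemma gadget_sum:
  "(\<Sum>T\<in>Pow inner_vertices. if gadget_ok a b T then z ^ card T else 0)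
    = (1 + z) * edge_factor z ((if a then 1 else 0) + (if b then 1 else 0))"
    (is "_ = ?R") for z :: "'r::comm_ring_1"
proof -
  have "(\<Sum>T\<in>Pow inner_vertices. if gadget_ok a b T then z ^ card T else 0) = ?R" if "a \<in> {True, False}" "b \<in> {True, False}"
    unfolding inner_vertices_def
    using that by (auto simp: sum_Pow_insert gadget_ok_def edge_factor_def power2_eq_square algebra_simps eval_nat_numeral)
  then show ?thesis by auto
qed

context
  fixes G :: "'a ugraph" and t :: "'a set \<Rightarrow> 'a \<times> 'a"
  assumes G: "finite_simple_graph G" and t: "orientation G t"
begin

lemma finite_edges: "finite (edges G)"
  by (rule finite_subset[of _ "Pow (verts G)"]) (use G in \<open>auto simp: finite_simple_graph_def\<close>)

lemma orientation_edge:
  assumes "e \<in> edges G"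
  shows "e = {fst (t e), snd (t e)}" "fst (t e) \<noteq> snd (t e)" "fst (t e) \<in> verts G" "snd (t e) \<in> verts G"
proof -
  show e: "e = {fst (t e), snd (t e)}" using t assms by (simp add: orientation_def)
  have "card e = 2" "e \<subseteq> verts G" using G assms by (auto simp: finite_simple_graph_def)
  then show "fst (t e) \<noteq> snd (t e)" "fst (t e) \<in> verts G" "snd (t e) \<in> verts G"
    by (subst (asm) (1 2) e; auto)+
qed

lemma copy_vertex_simps:
  "copy_vertex P1 P4 t e P1 = Old (fst (t e))" "copy_vertex P1 P4 t e P4 = Old (snd (t e))"
  "x \<in> inner_vertices \<Longrightarrow> copy_vertex P1 P4 t e x = New e x"
  by (auto simp: copy_vertex_def inner_vertices_def)

lemma UNIV_w4_vertex: "(UNIV :: w4_vertex set) = insert P1 (insert P4 inner_vertices)"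
  using w4_vertex.exhaust by (auto simp: inner_vertices_def)

lemma verts_R_W4: "verts (R_W4 t G) = Old ` verts G \<union> (\<lambda>(e, x). New e x) ` (edges G \<times> inner_vertices)"
proof -
  have "copy_vertex P1 P4 t e ` UNIV = insert (Old (fst (t e))) (insert (Old (snd (t e))) (New e ` inner_vertices))" for e
    unfolding UNIV_w4_vertex using copy_vertex_simps by (auto simp: image_iff)
  then show ?thesis
    using orientation_edge by (auto simp: R_W4_def replace_edges_def W4_def)
qed

lemma edges_free_R_W4:
  "(\<forall>u\<in>K. \<forall>v\<in>K. {u, v} \<notin> edges (R_W4 t G)) \<longleftrightarrow>
   (\<forall>e\<in>edges G. gadget_ok (Old (fst (t e)) \<in> K) (Old (snd (t e)) \<in> K) {x \<in> inner_vertices. New e x \<in> K})"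
proof -
  have 1: "(\<forall>u\<in>K. \<forall>v\<in>K. {u, v} \<notin> edges (R_W4 t G)) \<longleftrightarrow>
     (\<forall>e\<in>edges G. \<forall>f\<in>edges W4. \<not> copy_vertex P1 P4 t e ` f \<subseteq> K)"
  proof -
    have two: "\<exists>x y. f = {x, y}" if "f \<in> edges W4" for f
      using that by (auto simp: W4_def)
    show ?thesis
    proof (intro iffI ballI notI)
      fix e f assume *: "\<forall>u\<in>K. \<forall>v\<in>K. {u, v} \<notin> edges (R_W4 t G)" "e \<in> edges G" "f \<in> edges W4"
        "copy_vertex P1 P4 t e ` f \<subseteq> K"
      then obtain x y where "f = {x, y}" using two by blast
      with *(4) have "copy_vertex P1 P4 t e x \<in> K" "copy_vertex P1 P4 t e y \<in> K"
        and "copy_vertex P1 P4 t e ` f = {copy_vertex P1 P4 t e x, copy_vertex P1 P4 t e y}" by auto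
      moreover have "copy_vertex P1 P4 t e ` f \<in> edges (R_W4 t G)"
        using *(2,3) by (auto simp: R_W4_def replace_edges_def)
      ultimately show False using *(1) by auto
    next
      fix u v assume *: "\<forall>e\<in>edges G. \<forall>f\<in>edges W4. \<not> copy_vertex P1 P4 t e ` f \<subseteq> K" "u \<in> K" "v \<in> K"
        "{u, v} \<in> edges (R_W4 t G)"
      then obtain e f where "e \<in> edges G" "f \<in> edges W4" "{u, v} = copy_vertex P1 P4 t e ` f"
        by (auto simp: R_W4_def replace_edges_def)
      moreover from this have "copy_vertex P1 P4 t e ` f \<subseteq> K" using *(2,3) by auto
      ultimately show False using *(1) by blast
    qed
  qed
  have 2: "(\<forall>f\<in>edges W4. \<not> copy_vertex P1 P4 t e ` f \<subseteq> K) \<longleftrightarrow>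
     gadget_ok (Old (fst (t e)) \<in> K) (Old (snd (t e)) \<in> K) {x \<in> inner_vertices. New e x \<in> K}" for e
    by (auto simp: W4_def gadget_ok_def copy_vertex_def inner_vertices_def)
  show ?thesis unfolding 1 2 ..
qed

definition assemble :: "'a set \<Rightarrow> ('a set \<Rightarrow> w4_vertex set) \<Rightarrow> ('a, w4_vertex) rvertex set" where
  "assemble S c = Old ` S \<union> (\<lambda>(e, x). New e x) ` (SIGMA e:edges G. c e)"

text \<open>Once the set of chosen old vertices is fixed, the copies of \<open>W4\<close> do not influence each other, so the
sum factors over the edges.\<close>

lemma independence_sum:
  fixes z :: "'r::comm_ring_1"
  shows "(\<Sum>K | independent (R_W4 t G) K. z ^ card K) = (1 + z) ^ card (edges G) * subset_sum (verts G) (edges G) z"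
proof -
  let ?V = "verts G" and ?E = "edges G"
  have finV: "finite ?V" using G by (simp add: finite_simple_graph_def)
  have finI: "finite inner_vertices" by (simp add: inner_vertices_def)
  define D where "D = Pow ?V \<times> (?E \<rightarrow>\<^sub>E Pow inner_vertices)"
  define ok where "ok = (\<lambda>S e T. gadget_ok (fst (t e) \<in> S) (snd (t e) \<in> S) T)"
  have finD: "finite D" unfolding D_def using finV finite_edges finI by (intro finite_cartesian_product finite_PiE) auto
  have mem: "Old v \<in> assemble S c \<longleftrightarrow> v \<in> S" "New e x \<in> assemble S c \<longleftrightarrow> e \<in> ?E \<and> x \<in> c e" for v S c e x
    by (auto simp: assemble_def)
  have indep: "independent (R_W4 t G) (assemble S c) \<longleftrightarrow> (\<forall>e\<in>?E. ok S e (c e))" if "(S, c) \<in> D" for S c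
  proof -
    have "assemble S c \<subseteq> verts (R_W4 t G)"
    proof -
      have "S \<subseteq> ?V" "(SIGMA e:?E. c e) \<subseteq> ?E \<times> inner_vertices"
        using that by (auto simp: D_def PiE_iff)
      then show ?thesis
        unfolding verts_R_W4 assemble_def by (intro Un_mono image_mono)
    qed
    moreover have "{x \<in> inner_vertices. New e x \<in> assemble S c} = c e" if "e \<in> ?E" for e
      using that \<open>(S, c) \<in> D\<close> unfolding mem by (auto simp: D_def)
    ultimately show ?thesis
      unfolding independent_def edges_free_R_W4 ok_def mem by simp
  qed
  have card: "card (assemble S c) = card S + (\<Sum>e\<in>?E. card (c e))" if "(S, c) \<in> D" for S c
  proof -
    have "S \<subseteq> ?V" "\<And>e. e \<in> ?E \<Longrightarrow> c e \<subseteq> inner_vertices"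
      using that by (auto simp: D_def PiE_iff)
    then have fin: "finite S" "\<And>e. e \<in> ?E \<Longrightarrow> finite (c e)"
      using finite_subset[OF _ finV] finite_subset[OF _ finI] by auto
    have "card (assemble S c) = card (Old ` S :: ('a, w4_vertex) rvertex set) + card ((\<lambda>(e, x). New e x :: ('a, w4_vertex) rvertex) ` (SIGMA e:?E. c e))"
      unfolding assemble_def using fin finite_edges by (intro card_Un_disjoint) auto
    also have "card (Old ` S :: ('a, w4_vertex) rvertex set) = card S"
      by (intro card_image) (auto simp: inj_on_def)
    also have "card ((\<lambda>(e, x). New e x :: ('a, w4_vertex) rvertex) ` (SIGMA e:?E. c e)) = card (SIGMA e:?E. c e)"
      by (intro card_image) (auto simp: inj_on_def)
    finally show ?thesis using fin finite_edges by simp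
  qed
  have inj: "inj_on (\<lambda>(S, c). assemble S c) D"
  proof (intro inj_onI, clarify)
    fix S c S' c' assume D: "(S, c) \<in> D" "(S', c') \<in> D" and eq: "assemble S c = assemble S' c'"
    have "S = S'" using mem(1)[of _ S c] mem(1)[of _ S' c'] eq by auto
    moreover have "c = c'"
    proof (rule PiE_ext)
      show "c \<in> ?E \<rightarrow>\<^sub>E Pow inner_vertices" "c' \<in> ?E \<rightarrow>\<^sub>E Pow inner_vertices" using D by (auto simp: D_def)
      fix e assume "e \<in> ?E"
      then show "c e = c' e" using mem(2)[of e _ S c] mem(2)[of e _ S' c'] eq by auto
    qed
    ultimately show "S = S' \<and> c = c'" by simp
  qed
  have inj': "inj_on (\<lambda>(S, c). assemble S c) {(S, c) \<in> D. \<forall>e\<in>?E. ok S e (c e)}"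
    by (rule inj_on_subset[OF inj]) auto
  have img: "{K. independent (R_W4 t G) K} = (\<lambda>(S, c). assemble S c) ` {(S, c) \<in> D. \<forall>e\<in>?E. ok S e (c e)}"
  proof (intro equalityI subsetI)
    fix K assume "K \<in> {K. independent (R_W4 t G) K}"
    then have K: "independent (R_W4 t G) K" by simp
    define S where "S = {v \<in> ?V. Old v \<in> K}"
    define c where "c = restrict (\<lambda>e. {x \<in> inner_vertices. New e x \<in> K}) ?E"
    have D: "(S, c) \<in> D" by (auto simp: S_def c_def D_def)
    have "K \<subseteq> verts (R_W4 t G)" using K by (simp add: independent_def)
    then have "K = assemble S c"
      unfolding verts_R_W4 by (auto simp: assemble_def S_def c_def image_iff)
    moreover from this have "\<forall>e\<in>?E. ok S e (c e)" using K indep[OF D] by simp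
    ultimately show "K \<in> (\<lambda>(S, c). assemble S c) ` {(S, c) \<in> D. \<forall>e\<in>?E. ok S e (c e)}"
      using D by (intro image_eqI[where x = "(S, c)"]) auto
  next
    fix K assume "K \<in> (\<lambda>(S, c). assemble S c) ` {(S, c) \<in> D. \<forall>e\<in>?E. ok S e (c e)}"
    then obtain y where "K = (\<lambda>(S, c). assemble S c) y" "y \<in> {(S, c) \<in> D. \<forall>e\<in>?E. ok S e (c e)}"
      by (rule imageE)
    then obtain S c where K: "K = assemble S c" "(S, c) \<in> D" "\<forall>e\<in>?E. ok S e (c e)"
      by (cases y) simp
    show "K \<in> {K. independent (R_W4 t G) K}"
      unfolding K(1) mem_Collect_eq indep[OF K(2)] by (rule K(3))
  qed
  have factor: "(if ok S e T then z ^ card T else 0) = (if gadget_ok (fst (t e) \<in> S) (snd (t e) \<in> S) T then z ^ card T else 0)" for S e T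
    by (simp add: ok_def)
  have "(\<Sum>K | independent (R_W4 t G) K. z ^ card K)
     = (\<Sum>(S, c)\<in>{(S, c) \<in> D. \<forall>e\<in>?E. ok S e (c e)}. z ^ card (assemble S c))"
    unfolding img sum.reindex[OF inj'] by (simp add: case_prod_unfold)
  also have "\<dots> = (\<Sum>(S, c)\<in>{(S, c) \<in> D. \<forall>e\<in>?E. ok S e (c e)}. z ^ card S * (\<Prod>e\<in>?E. if ok S e (c e) then z ^ card (c e) else 0))"
    by (intro sum.cong refl) (auto simp: card power_add power_sum)
  also have "\<dots> = (\<Sum>(S, c)\<in>D. z ^ card S * (\<Prod>e\<in>?E. if ok S e (c e) then z ^ card (c e) else 0))"
  proof (intro sum.mono_neutral_left finD ballI)
    fix p assume "p \<in> D - {(S, c) \<in> D. \<forall>e\<in>?E. ok S e (c e)}"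
    then obtain S c where p: "p = (S, c)" "\<exists>e\<in>?E. \<not> ok S e (c e)" by (cases p) auto
    then have "(\<Prod>e\<in>?E. if ok S e (c e) then z ^ card (c e) else 0) = 0"
      by (intro prod_zero[OF finite_edges]) auto
    then show "(case p of (S, c) \<Rightarrow> z ^ card S * (\<Prod>e\<in>?E. if ok S e (c e) then z ^ card (c e) else 0)) = 0"
      using p(1) by simp
  qed auto
  also have "\<dots> = (\<Sum>S\<in>Pow ?V. z ^ card S * (\<Sum>c\<in>?E \<rightarrow>\<^sub>E Pow inner_vertices. \<Prod>e\<in>?E. if ok S e (c e) then z ^ card (c e) else 0))"
    unfolding D_def by (simp add: sum.cartesian_product sum_distrib_left)
  also have "\<dots> = (\<Sum>S\<in>Pow ?V. z ^ card S * (\<Prod>e\<in>?E. (1 + z) * edge_factor z (card (e \<inter> S))))"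
  proof (intro sum.cong refl arg_cong2[where f = times])
    fix S
    have "(\<Sum>c\<in>?E \<rightarrow>\<^sub>E Pow inner_vertices. \<Prod>e\<in>?E. if ok S e (c e) then z ^ card (c e) else 0)
      = (\<Prod>e\<in>?E. \<Sum>T\<in>Pow inner_vertices. if ok S e T then z ^ card T else 0)"
      using finite_edges finI by (subst prod_sum_PiE) auto
    also have "\<dots> = (\<Prod>e\<in>?E. (1 + z) * edge_factor z (card (e \<inter> S)))"
    proof (intro prod.cong refl)
      fix e assume e: "e \<in> ?E"
      have "card (e \<inter> S) = (if fst (t e) \<in> S then 1 else 0) + (if snd (t e) \<in> S then 1 else 0)"
        using card_pair_Int[OF orientation_edge(2)[OF e], of S] orientation_edge(1)[OF e] by simp
      then show "(\<Sum>T\<in>Pow inner_vertices. if ok S e T then z ^ card T else 0) = (1 + z) * edge_factor z (card (e \<inter> S))"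
        unfolding factor gadget_sum by simp
    qed
    finally show "(\<Sum>c\<in>?E \<rightarrow>\<^sub>E Pow inner_vertices. \<Prod>e\<in>?E. if ok S e (c e) then z ^ card (c e) else 0)
      = (\<Prod>e\<in>?E. (1 + z) * edge_factor z (card (e \<inter> S)))" .
  qed
  also have "\<dots> = (1 + z) ^ card ?E * subset_sum ?V ?E z"
    by (simp add: subset_sum_def prod.distrib sum_distrib_left mult_ac)
  finally show ?thesis .
qed

end

lemma independence_sum_eq_indep_count:
  fixes z :: "'r::comm_ring_1" and H :: "'b ugraph"
  assumes "finite (verts H)"
  shows "(\<Sum>K | independent H K. z ^ card K) = (\<Sum>k\<le>indep_number H. of_nat (indep_count H k) * z ^ k)"
proof -
  have fin: "finite {K. independent H K}"
    by (rule finite_subset[of _ "Pow (verts H)"]) (use assms in \<open>auto simp: independent_def\<close>)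
  have "card ` {K. independent H K} \<subseteq> {..indep_number H}"
    unfolding indep_number_def using fin by (auto simp: setcompr_eq_image intro!: Max_ge)
  then have "(\<Sum>K | independent H K. z ^ card K) = (\<Sum>k\<le>indep_number H. \<Sum>K\<in>{K \<in> {K. independent H K}. card K = k}. z ^ card K)"
    using fin by (intro sum.group[symmetric]) auto
  also have "\<dots> = (\<Sum>k\<le>indep_number H. of_nat (indep_count H k) * z ^ k)"
    by (intro sum.cong refl) (simp add: indep_count_def)
  finally show ?thesis .
qed

theorem theorem4p5:
  fixes G :: "'a ugraph" and t :: "'a set \<Rightarrow> 'a \<times> 'a"
  assumes "finite_simple_graph G" and "orientation G t"
  shows "log_concave_indep_seq (R_W4 t G)"
proof -
  let ?H = "R_W4 t G"
  have G: "finite (verts G)" "\<forall>e\<in>edges G. card e = 2 \<and> e \<subseteq> verts G"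
    using assms(1) by (auto simp: finite_simple_graph_def)
  have "finite (verts ?H)"
    unfolding verts_R_W4[OF assms] using G finite_edges[OF assms] by (simp add: inner_vertices_def)
  note count = independence_sum_eq_indep_count[OF this, symmetric]
  have "(1 + X) ^ card (edges G) * (1 + Y) ^ card (edges G) * (subset_sum (verts G) (edges G) X * subset_sum (verts G) (edges G) Y) \<in> schur_pos"
  proof (rule schur_pos_mult[OF _ subset_sum_schur_pos[OF G]])
    have "(1 + X) ^ card (edges G) * (1 + Y) ^ card (edges G) = (1 + (e1 + e2)) ^ card (edges G)"
      unfolding power_mult_distrib[symmetric] by (simp add: algebra_simps)
    then show "(1 + X) ^ card (edges G) * (1 + Y) ^ card (edges G) \<in> schur_pos"
      by (simp only: schur_pos_power[OF schur_pos_add[OF schur_pos_one schur_pos_add[OF schur_pos_e1 schur_pos_e2]]])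
  qed
  then have "(\<Sum>k\<le>indep_number ?H. of_nat (indep_count ?H k) * X ^ k)
     * (\<Sum>k\<le>indep_number ?H. of_nat (indep_count ?H k) * Y ^ k) \<in> schur_pos"
    unfolding count independence_sum[OF assms] by (simp only: mult_ac)
  from log_concave_if_schur_pos[OF this] show ?thesis
    by (simp add: log_concave_indep_seq_def log_concave_upto_def)
qed

end
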